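(* Let $G_1$ and $G_2$ be two realizations, on the same labeled vertex set, of the same degree sequence $\mathbf{d}=(d_1,\ldots,d_n)$. Then $$\mathbf{dist}_u(G_1,G_2)=H'(G_1,G_2)-\mathbf{maxC}_u(G_1,G_2).$$
   Context: All graphs are finite, simple and undirected, with labeled vertices $v_1,\dots,v_n$. A graph $G$ realizes a sequence $\mathbf d=(d_1,\dots,d_n)$ of positive integers if $d(v_i)=d_i$ for all $i$. Swap: if $a,b,c,d$ are four different vertices of $G$ with $(a,c),(b,d)\in E(G)$ and $(b,c),(a,d)\notin E(G)$, then a swap replaces $G$ by the graph $G'$ on the same vertex set with $E(G')=E(G)\setminus\{(a,c),(b,d)\}\cup\{(b,c),(a,d)\}$; $G'$ has the same degree sequence. $\mathbf{dist}_u(G_1,G_2)$ is the length (number of swaps) of a shortest sequence of swaps transforming $G_1$ into $G_2$. $H'(G_1,G_2)=|E(G_1)\,\Delta\, E(G_2)|/2$, where $\Delta$ is the symmetric difference. A red-blue graph is a graph with each edge colored red or blue; it is balanced if at each vertex the number of red edges equals the number of blue edges. The balanced red-blue graph associated with $G_1,G_2$ has the common vertex set, edge set $E(G_1)\,\Delta\, E(G_2)$, edges of $E(G_1)\setminus E(G_2)$ colored red and edges of $E(G_2)\setminus E(G_1)$ colored blue. A circuit is a closed trail $v_0,v_1,\dots,v_t=v_0$ (each edge used at most once; vertices may repeat). It is alternating if consecutive edges have different colors, including the last edge $v_{t-1}v_t$ and the first edge $v_0v_1$. The edge set of every balanced red-blue graph $G$ can be decomposed (partitioned) into alternating circuits;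 $\mathbf{maxC}_u(G)$ is the maximum number of circuits in such a decomposition, and $\mathbf{maxC}_u(G_1,G_2)=\mathbf{maxC}_u(G)$ for the associated balanced red-blue graph $G$. *)

theory Defs
  imports Main "HOL-Library.Disjoint_Sets" "HOL-Library.Extended_Real"
begin

text \<open>
  The vertex set \<open>V\<close> is shared by all graphs under consideration, so a graph is represented by its
  set of edges, each edge being a two-element set of vertices. A degree sequence is a function on
  the vertices, i.e. the vertices themselves serve as labels.
\<close>

definition simple_graph :: "'a set \<Rightarrow> 'a set set \<Rightarrow> bool" where
  "simple_graph V E \<longleftrightarrow> finite V \<and> (\<forall>e\<in>E. e \<subseteq> V \<and> card e = 2)"

definition degree :: "'a set set \<Rightarrow> 'a \<Rightarrow> nat" where
  "degree E v = card {e \<in> E. v \<in> e}"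

definition realizes :: "'a set \<Rightarrow> 'a set set \<Rightarrow> ('a \<Rightarrow> nat) \<Rightarrow> bool" where
  "realizes V E d \<longleftrightarrow> simple_graph V E \<and> (\<forall>v\<in>V. degree E v = d v)"

definition swap :: "'a set set \<Rightarrow> 'a set set \<Rightarrow> bool" where
  "swap E E' \<longleftrightarrow> (\<exists>a b c d. distinct [a, b, c, d] \<and>
     {a, c} \<in> E \<and> {b, d} \<in> E \<and> {b, c} \<notin> E \<and> {a, d} \<notin> E \<and>
     E' = (E - {{a, c}, {b, d}}) \<union> {{b, c}, {a, d}})"

text \<open>The value is \<open>\<infinity>\<close> if no sequence of swaps transforms the first graph into the second.\<close>

definition dist_u :: "'a set set \<Rightarrow> 'a set set \<Rightarrow> enat" where
  "dist_u E1 E2 = (INF k\<in>{k. (swap ^^ k) E1 E2}. enat k)"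

definition half_hamming :: "'a set set \<Rightarrow> 'a set set \<Rightarrow> real" where
  "half_hamming E1 E2 = real (card (sym_diff E1 E2)) / 2"

text \<open>
  A red-blue graph is given by its set \<open>R\<close> of red edges and its set \<open>B\<close> of blue edges.
\<close>

definition red_blue_graph :: "'a set \<Rightarrow> 'a set set \<Rightarrow> 'a set set \<Rightarrow> bool" where
  "red_blue_graph V R B \<longleftrightarrow> simple_graph V (R \<union> B) \<and> R \<inter> B = {}"

definition balanced :: "'a set \<Rightarrow> 'a set set \<Rightarrow> 'a set set \<Rightarrow> bool" where
  "balanced V R B \<longleftrightarrow> red_blue_graph V R B \<and> (\<forall>v\<in>V. degree R v = degree B v)"

text \<open>The edges \<open>{v\<^sub>0, v\<^sub>1}, \<dots>, {v\<^sub>t\<^sub>-\<^sub>1, v\<^sub>t}\<close> of the walk \<open>[v\<^sub>0, \<dots>, v\<^sub>t]\<close>.\<close>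

definition walk_edges :: "'a list \<Rightarrow> 'a set list" where
  "walk_edges vs = map2 (\<lambda>u v. {u, v}) vs (tl vs)"

text \<open>The list \<open>[v\<^sub>0, \<dots>, v\<^sub>t]\<close> representing a circuit includes the final vertex \<open>v\<^sub>t = v\<^sub>0\<close>.\<close>

definition circuit :: "'a set set \<Rightarrow> 'a list \<Rightarrow> bool" where
  "circuit E vs \<longleftrightarrow> length vs \<ge> 2 \<and> hd vs = last vs \<and>
     set (walk_edges vs) \<subseteq> E \<and> distinct (walk_edges vs)"

definition alternating_circuit :: "'a set set \<Rightarrow> 'a set set \<Rightarrow> 'a list \<Rightarrow> bool" where
  "alternating_circuit R B vs \<longleftrightarrow> circuit (R \<union> B) vs \<and>
     (let es = walk_edges vs in
       \<forall>i < length es. (es ! i \<in> R) \<noteq> (es ! (Suc i mod length es) \<in> R))"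

text \<open>
  A decomposition is recorded as the set of the edge sets of its circuits. These are nonempty and
  pairwise disjoint, so the cardinality of this set is the number of circuits.
\<close>

definition alternating_decomposition ::
    "'a set set \<Rightarrow> 'a set set \<Rightarrow> 'a set set set \<Rightarrow> bool" where
  "alternating_decomposition R B P \<longleftrightarrow> partition_on (R \<union> B) P \<and>
     (\<forall>C\<in>P. \<exists>vs. alternating_circuit R B vs \<and> set (walk_edges vs) = C)"

definition maxC :: "'a set set \<Rightarrow> 'a set set \<Rightarrow> nat" where
  "maxC R B = Max (card ` {P. alternating_decomposition R B P})"

definition maxC_u :: "'a set set \<Rightarrow> 'a set set \<Rightarrow> nat" where
  "maxC_u E1 E2 = maxC (E1 - E2) (E2 - E1)"

lemma associated_graph_balanced:
  assumes "realizes V E1 d" and "realizes V E2 d"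
  shows "balanced V (E1 - E2) (E2 - E1)"
proof -
  have g: "simple_graph V E1" "simple_graph V E2"
    and d: "\<And>v. v \<in> V \<Longrightarrow> degree E1 v = degree E2 v"
    using assms by (auto simp: realizes_def)
  have fin: "finite E1" "finite E2"
  proof -
    have "E1 \<subseteq> Pow V" "E2 \<subseteq> Pow V" "finite (Pow V)"
      using g unfolding simple_graph_def by auto
    then show "finite E1" "finite E2"
      by (metis finite_subset)+
  qed
  have split: "degree A v = degree (A - B) v + degree (A \<inter> B) v"
    if "finite A" for A B :: "'a set set" and v
  proof -
    have "{e \<in> A. v \<in> e} = {e \<in> A - B. v \<in> e} \<union> {e \<in> A \<inter> B. v \<in> e}"
      by blast
    moreover have "card ({e \<in> A - B. v \<in> e} \<union> {e \<in> A \<inter> B. v \<in> e}) =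
        card {e \<in> A - B. v \<in> e} + card {e \<in> A \<inter> B. v \<in> e}"
      by (rule card_Un_disjoint) (use that in auto)
    ultimately show ?thesis
      unfolding degree_def by simp
  qed
  have "degree (E1 - E2) v = degree (E2 - E1) v" if "v \<in> V" for v
    using split[OF fin(1), of v E2] split[OF fin(2), of v E1] d[OF that]
    by (metis Int_commute add_right_cancel)
  then show ?thesis
    using g unfolding balanced_def red_blue_graph_def simple_graph_def by blast
qed

end

theory Submission
  imports Defs
begin

text \<open>
  Give each edge of \<open>G1 - G2\<close> the weight 1 and each edge of \<open>G2 - G1\<close> the weight -1. A maximum
  decomposition into alternating circuits is a maximum partition of the symmetric difference into
  nonempty sets whose weights cancel at every vertex. More generally, decompose the weight function
  into a sum of balanced integer functions, where a nonzero function of norm \<open>N\<close> costs \<open>N - 2\<close>: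
  adding up two functions with opposite signs on some edge never increases the cost, so the minimum
  cost, which is twice the claimed distance, is attained by partitions. A swap adds a 4-cycle of
  cost 2, which gives the lower bound. For the upper bound, some swap cuts a circuit of a maximum
  partition into two balanced pieces whose total cost is smaller by 2.
\<close>

section \<open>Balanced weight functions\<close>

text \<open>Handling circuits directly would need a case distinction after each swap: a swapped pair
  may lie in both graphs, in neither, in another circuit, or on the very circuit being cut. Integer
  functions absorb all these cases. A swap changes the sign function by the same 4-cycle whatever
  \<open>G2\<close> is, and overlaps show up only as values that add or cancel. The constant 2 in
  the cost fits twice: it is what each further circuit saves in the doubled distance, and it is the
  least drop of the norm when two integers of opposite signs are added. A second obstacle is that
  circuits may repeat vertices, while a swap needs four different ones. The circuit to be cut is
  therefore read from a vertex that it visits only once. Such a vertex exists because the parts of a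
  maximum partition are minimal balanced sets.\<close>

definition vertex_weight :: "('a set \<Rightarrow> int) \<Rightarrow> 'a set set \<Rightarrow> 'a \<Rightarrow> int" where
  "vertex_weight F S v = (\<Sum>e\<in>S. F e * of_bool (v \<in> e))"

definition balanced_parts :: "('a set \<Rightarrow> int) \<Rightarrow> 'a set set set \<Rightarrow> bool" where
  "balanced_parts F P \<longleftrightarrow> partition_on {e. F e \<noteq> 0} P \<and> (\<forall>C\<in>P. \<forall>v. vertex_weight F C v = 0)"

text \<open>The zero function gets 0 and not -2: it stands for no circuit at all, so nothing may be
  gained by including it in a family.\<close>

definition cost :: "'a set set \<Rightarrow> ('a set \<Rightarrow> int) \<Rightarrow> int" where
  "cost U f = (if \<forall>e\<in>U. f e = 0 then 0 else (\<Sum>e\<in>U. \<bar>f e\<bar>) - 2)"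

lemma vertex_weight_add:
  "vertex_weight (\<lambda>e. f e + g e) S v = vertex_weight f S v + vertex_weight g S v"
  by (simp add: vertex_weight_def sum.distrib algebra_simps)

lemma vertex_weight_Un:
  "finite A \<Longrightarrow> finite B \<Longrightarrow> A \<inter> B = {} \<Longrightarrow>
    vertex_weight F (A \<union> B) v = vertex_weight F A v + vertex_weight F B v"
  unfolding vertex_weight_def by (rule sum.union_disjoint)

lemma vertex_weight_restrict:
  assumes "finite U" "C \<subseteq> U"
  shows "vertex_weight (\<lambda>e. if e \<in> C then F e else 0) U v = vertex_weight F C v"
  unfolding vertex_weight_def
  by (rule sum.mono_neutral_cong_right) (use assms in auto)

lemma vertex_weight_support:
  assumes "finite U" "\<And>e. f e \<noteq> 0 \<Longrightarrow> e \<in> U"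
  shows "vertex_weight f {e. f e \<noteq> 0} v = vertex_weight f U v"
  unfolding vertex_weight_def
  by (rule sum.mono_neutral_left) (use assms in auto)

text \<open>At an endpoint of \<open>e\<close> the weight would otherwise be just
  \<open>F e\<close>. Excluding the empty edge guarantees that there is an endpoint.\<close>

lemma balanced_two_edges:
  assumes "finite S" "{} \<notin> S" "\<And>v. vertex_weight F S v = 0" "e \<in> S" "F e \<noteq> 0"
  shows "\<exists>e'\<in>S. e' \<noteq> e \<and> F e' \<noteq> 0"
proof (rule ccontr)
  assume "\<not> ?thesis"
  then have zero: "\<And>e'. e' \<in> S - {e} \<Longrightarrow> F e' = 0" by auto
  obtain v where "v \<in> e" using assms(2,4) by (metis all_not_in_conv)
  have "vertex_weight F S v = F e * of_bool (v \<in> e) + (\<Sum>x\<in>S - {e}. F x * of_bool (v \<in> x))"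
    unfolding vertex_weight_def by (rule sum.remove) (use assms in auto)
  also have "\<dots> = F e"
    using \<open>v \<in> e\<close> zero by simp
  finally show False using assms by auto
qed

lemma balanced_norm_ge_2:
  assumes "finite U" "{} \<notin> U" "\<And>v. vertex_weight f U v = 0" "e \<in> U" "f e \<noteq> 0"
  shows "(\<Sum>e\<in>U. \<bar>f e\<bar>) \<ge> 2"
proof -
  obtain e' where "e' \<in> U" "e' \<noteq> e" "f e' \<noteq> 0"
    using balanced_two_edges[OF assms] by blast
  then have "(\<Sum>x\<in>{e, e'}. \<bar>f x\<bar>) \<ge> 2" using assms by auto
  moreover have "(\<Sum>x\<in>{e, e'}. \<bar>f x\<bar>) \<le> (\<Sum>x\<in>U. \<bar>f x\<bar>)"
    by (rule sum_mono2) (use assms \<open>e' \<in> U\<close> in auto)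
  ultimately show ?thesis by linarith
qed

lemma cost_nonneg:
  assumes "finite U" "{} \<notin> U" "\<And>v. vertex_weight f U v = 0"
  shows "cost U f \<ge> 0"
  using balanced_norm_ge_2[OF assms] by (auto simp: cost_def)

text \<open>The cancellation on \<open>e\<close> pays for having one \<open>- 2\<close> in place of
  two. If the two functions cancel completely, the bound is \<open>cost_nonneg\<close>, which is
  where balance enters.\<close>

lemma cost_merge:
  assumes U: "finite U" "{} \<notin> U"
    and bal: "\<And>v. vertex_weight f U v = 0" "\<And>v. vertex_weight g U v = 0"
    and e: "e \<in> U" "f e * g e < 0"
  shows "cost U (\<lambda>x. f x + g x) \<le> cost U f + cost U g"
proof (cases "\<forall>x\<in>U. f x + g x = 0")
  case True
  then show ?thesis
    using cost_nonneg[OF U bal(1)] cost_nonneg[OF U bal(2)] by (simp add: cost_def)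
next
  case False
  have "\<bar>f e + g e\<bar> \<le> \<bar>f e\<bar> + \<bar>g e\<bar> - 2"
    using e(2) by (auto simp: mult_less_0_iff)
  moreover have "(\<Sum>x\<in>U - {e}. \<bar>f x + g x\<bar>) \<le> (\<Sum>x\<in>U - {e}. \<bar>f x\<bar>) + (\<Sum>x\<in>U - {e}. \<bar>g x\<bar>)"
    by (simp flip: sum.distrib add: sum_mono abs_triangle_ineq)
  ultimately have "(\<Sum>x\<in>U. \<bar>f x + g x\<bar>) \<le> (\<Sum>x\<in>U. \<bar>f x\<bar>) + (\<Sum>x\<in>U. \<bar>g x\<bar>) - 2"
    using U e(1) by (simp add: sum.remove)
  moreover have "f e \<noteq> 0" "g e \<noteq> 0" using e(2) by auto
  ultimately show ?thesis
    using False e(1) by (auto simp: cost_def)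
qed

text \<open>End point of the merging process: on its support each member coincides with the sum, so
  its values there are 1 or -1, and the supports are the parts.\<close>

lemma disjoint_family_parts:
  fixes f :: "'i \<Rightarrow> 'a set \<Rightarrow> int"
  assumes fin: "finite I" "finite U"
    and supp: "\<And>i e. i \<in> I \<Longrightarrow> f i e \<noteq> 0 \<Longrightarrow> e \<in> U"
    and bal: "\<And>i v. i \<in> I \<Longrightarrow> vertex_weight (f i) U v = 0"
    and le1: "\<And>e. \<bar>\<Sum>i\<in>I. f i e\<bar> \<le> 1"
    and disj: "\<And>i j e. i \<in> I \<Longrightarrow> j \<in> I \<Longrightarrow> i \<noteq> j \<Longrightarrow> f i e = 0 \<or> f j e = 0"
  shows "\<exists>P. balanced_parts (\<lambda>e. \<Sum>i\<in>I. f i e) P \<and>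
    int (card {e. (\<Sum>i\<in>I. f i e) \<noteq> 0}) - 2 * int (card P) \<le> (\<Sum>i\<in>I. cost U (f i))"
proof -
  define F where "F = (\<lambda>e. \<Sum>i\<in>I. f i e)"
  define s where "s = (\<lambda>i. {e. f i e \<noteq> 0})"
  \<comment> \<open>Zero members have empty support, which a partition must not contain; dropping
    them leaves the cost unchanged.\<close>
  define J where "J = {i \<in> I. s i \<noteq> {}}"
  have finJ: "finite J" using fin by (simp add: J_def)
  have F: "F e = f i e" if "i \<in> I" "e \<in> s i" for i e
  proof -
    have "(\<Sum>j\<in>I - {i}. f j e) = 0"
      by (rule sum.neutral) (use that disj in \<open>auto simp: s_def\<close>)
    then show ?thesis using that fin by (simp add: F_def sum.remove)
  qed
  have suppF: "{e. F e \<noteq> 0} = (\<Union>i\<in>J. s i)"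
  proof (intro equalityI subsetI)
    fix e assume "e \<in> {e. F e \<noteq> 0}"
    then obtain i where "i \<in> I" "f i e \<noteq> 0"
      unfolding F_def by (metis (mono_tags, lifting) mem_Collect_eq sum.neutral)
    then show "e \<in> (\<Union>i\<in>J. s i)" by (auto simp: J_def s_def)
  next
    fix e assume "e \<in> (\<Union>i\<in>J. s i)"
    then show "e \<in> {e. F e \<noteq> 0}" using F by (auto simp: J_def s_def)
  qed
  have sdisj: "s i \<inter> s j = {}" if "i \<in> J" "j \<in> J" "i \<noteq> j" for i j
    using that disj by (auto simp: s_def J_def)
  have inj: "inj_on s J"
    by (rule inj_onI) (metis (mono_tags, lifting) J_def inf.idem mem_Collect_eq sdisj)
  have "partition_on {e. F e \<noteq> 0} (s ` J)"
    by (rule partition_onI) (use sdisj suppF in \<open>auto simp: J_def disjnt_def\<close>)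
  moreover have "vertex_weight F (s i) v = 0" if "i \<in> J" for i v
  proof -
    have "vertex_weight F (s i) v = vertex_weight (f i) (s i) v"
      unfolding vertex_weight_def using that F by (intro sum.cong) (auto simp: J_def)
    also have "\<dots> = vertex_weight (f i) U v"
      unfolding s_def by (rule vertex_weight_support) (use fin supp that in \<open>auto simp: J_def\<close>)
    finally show ?thesis using bal that by (simp add: J_def)
  qed
  ultimately have "balanced_parts F (s ` J)" by (auto simp: balanced_parts_def)
  moreover have "int (card {e. F e \<noteq> 0}) - 2 * int (card (s ` J)) \<le> (\<Sum>i\<in>I. cost U (f i))"
  proof -
    have fins: "finite (s i)" if "i \<in> J" for i
      by (rule finite_subset[of _ U]) (use supp that fin in \<open>auto simp: s_def J_def\<close>)
    have "cost U (f i) = int (card (s i)) - 2" if "i \<in> J" for i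
    proof -
      have i: "i \<in> I" using that by (simp add: J_def)
      have "(\<Sum>e\<in>U. \<bar>f i e\<bar>) = (\<Sum>e\<in>s i. \<bar>f i e\<bar>)"
        by (rule sum.mono_neutral_right) (use i fin supp in \<open>auto simp: s_def\<close>)
      also have "\<dots> = (\<Sum>e\<in>s i. 1)"
      proof (rule sum.cong)
        fix e assume e: "e \<in> s i"
        then have "F e \<noteq> 0" using F[OF i e] by (simp add: s_def)
        then show "\<bar>f i e\<bar> = 1" using F[OF i e] le1[of e] by (auto simp: F_def)
      qed simp
      finally show ?thesis
        using that supp by (auto simp: cost_def J_def s_def)
    qed
    then have "(\<Sum>i\<in>J. cost U (f i)) = (\<Sum>i\<in>J. int (card (s i))) - 2 * int (card J)"
      by (simp add: sum_subtractf)
    moreover have "(\<Sum>i\<in>I. cost U (f i)) = (\<Sum>i\<in>J. cost U (f i))"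
      by (rule sum.mono_neutral_right) (use fin in \<open>auto simp: J_def s_def cost_def\<close>)
    moreover have "card (\<Union>i\<in>J. s i) = (\<Sum>i\<in>J. card (s i))"
      by (rule card_UN_disjoint) (use finJ fins sdisj in auto)
    ultimately show ?thesis
      using suppF card_image[OF inj] by simp
  qed
  ultimately show ?thesis unfolding F_def by blast
qed

text \<open>
  Two members with opposite signs on an edge are replaced by their sum: this removes one member,
  but the total norm drops by at least 2, so the cost does not grow.
\<close>

lemma family_parts:
  fixes f :: "'i \<Rightarrow> 'a set \<Rightarrow> int"
  assumes "finite I" and U: "finite U" "{} \<notin> U"
    and "\<And>i e. i \<in> I \<Longrightarrow> f i e \<noteq> 0 \<Longrightarrow> e \<in> U"
    and "\<And>i v. i \<in> I \<Longrightarrow> vertex_weight (f i) U v = 0"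
    and "\<And>e. \<bar>\<Sum>i\<in>I. f i e\<bar> \<le> 1"
  shows "\<exists>P. balanced_parts (\<lambda>e. \<Sum>i\<in>I. f i e) P \<and>
    int (card {e. (\<Sum>i\<in>I. f i e) \<noteq> 0}) - 2 * int (card P) \<le> (\<Sum>i\<in>I. cost U (f i))"
  using assms(1,4-)
proof (induction "card I" arbitrary: I f rule: less_induct)
  case less
  note fin = less.prems(1) and supp = less.prems(2) and bal = less.prems(3) and le1 = less.prems(4)
  show ?case
  proof (cases "\<exists>i\<in>I. \<exists>j\<in>I. \<exists>e. i \<noteq> j \<and> f i e * f j e < 0")
    case True
    then obtain i j e where ij: "i \<in> I" "j \<in> I" "i \<noteq> j" and e: "f i e * f j e < 0" by blast
    define g where "g = f(i := \<lambda>x. f i x + f j x)"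
    let ?J = "I - {j}"
    have split: "(\<Sum>k\<in>I. h k) = h i + h j + (\<Sum>k\<in>I - {j} - {i}. h k)"
      for h :: "'i \<Rightarrow> int"
      using fin ij sum.remove[of I j h] sum.remove[of "I - {j}" i h] by simp
    have split': "(\<Sum>k\<in>?J. h k) = h i + (\<Sum>k\<in>I - {j} - {i}. h k)" for h :: "'i \<Rightarrow> int"
      using fin ij by (simp add: sum.remove)
    have sum_eq: "(\<Sum>k\<in>?J. g k x) = (\<Sum>k\<in>I. f k x)" for x
      unfolding split split' g_def by simp
    have "e \<in> U" using supp[OF ij(1), of e] e by (cases "f i e = 0") auto
    then have c: "cost U (g i) \<le> cost U (f i) + cost U (f j)"
      unfolding g_def using cost_merge[OF U bal[OF ij(1)] bal[OF ij(2)] _ e] by simp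
    have "card ?J < card I" using ij fin by (intro card_Diff1_less)
    moreover have "finite ?J" using fin by simp
    moreover have "x \<in> U" if "k \<in> ?J" "g k x \<noteq> 0" for k x
    proof (cases "k = i")
      case True
      then have "f i x \<noteq> 0 \<or> f j x \<noteq> 0" using that by (auto simp: g_def)
      then show ?thesis using supp ij by blast
    next
      case False
      then show ?thesis using that supp by (auto simp: g_def)
    qed
    moreover have "vertex_weight (g k) U v = 0" if "k \<in> ?J" for k v
      using that bal ij by (auto simp: g_def vertex_weight_add)
    moreover have "\<bar>\<Sum>k\<in>?J. g k x\<bar> \<le> 1" for x
      unfolding sum_eq by (rule le1)
    ultimately obtain P where P: "balanced_parts (\<lambda>e. \<Sum>k\<in>?J. g k e) P"
      "int (card {e. (\<Sum>k\<in>?J. g k e) \<noteq> 0}) - 2 * int (card P) \<le> (\<Sum>k\<in>?J. cost U (g k))"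
      using less.hyps[of ?J g] by blast
    have "(\<Sum>k\<in>?J. cost U (g k)) \<le> (\<Sum>k\<in>I. cost U (f k))"
      unfolding split split' using c by (simp add: g_def)
    then show ?thesis using P unfolding sum_eq by (meson order_trans)
  next
    case False
    \<comment> \<open>All members now agree in sign on \<open>e\<close>, so two nonzero values there
      would give a sum of modulus greater than 1. Multiplying by \<open>f i e\<close> makes every
      term nonnegative without a case split on the sign.\<close>
    have disj: "f i e = 0 \<or> f j e = 0" if "i \<in> I" "j \<in> I" "i \<noteq> j" for i j e
    proof (rule ccontr)
      assume nz: "\<not> ?thesis"
      have "f i e * f j e > 0" using False that nz
        by (metis less_linear mult_eq_0_iff)
      moreover have "(\<Sum>k\<in>I - {i} - {j}. f i e * f k e) \<ge> 0"
      proof (rule sum_nonneg)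
        fix k assume "k \<in> I - {i} - {j}"
        then show "0 \<le> f i e * f k e" using False that(1) by (metis DiffE insertI1 not_less)
      qed
      moreover have "f i e * (\<Sum>k\<in>I. f k e) = f i e * f i e + f i e * f j e +
          (\<Sum>k\<in>I - {i} - {j}. f i e * f k e)"
        using fin that sum.remove[of I i "\<lambda>k. f i e * f k e"]
          sum.remove[of "I - {i}" j "\<lambda>k. f i e * f k e"] by (simp add: sum_distrib_left)
      ultimately have gt: "f i e * (\<Sum>k\<in>I. f k e) > f i e * f i e" by linarith
      have "f i e * (\<Sum>k\<in>I. f k e) \<le> \<bar>f i e\<bar> * \<bar>\<Sum>k\<in>I. f k e\<bar>"
        by (metis abs_ge_self abs_mult)
      also have "\<dots> \<le> \<bar>f i e\<bar> * 1" by (rule mult_left_mono) (use le1 in auto)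
      also have "\<dots> \<le> \<bar>f i e\<bar> * \<bar>f i e\<bar>" by (rule mult_left_mono) (use nz in auto)
      also have "\<dots> = f i e * f i e" by simp
      finally show False using gt by linarith
    qed
    show ?thesis by (rule disjoint_family_parts) (use fin U supp bal le1 disj in auto)
  qed
qed

section \<open>Edge signs and partitions of the symmetric difference\<close>

lemma sum_of_bool_single:
  assumes "finite U" "x \<in> U"
  shows "(\<Sum>e\<in>U. of_bool (e = x) * g e) = (g x :: int)"
proof -
  have "(\<Sum>e\<in>U. of_bool (e = x) * g e) = (\<Sum>e\<in>{x}. of_bool (e = x) * g e)"
    by (rule sum.mono_neutral_right) (use assms in auto)
  then show ?thesis by simp
qed

text \<open>As a difference of indicator functions it is additive under changes of
  \<open>E1\<close>, so a swap contributes the same function for every \<open>E2\<close>.\<close>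

definition edge_sign :: "'a set set \<Rightarrow> 'a set set \<Rightarrow> 'a set \<Rightarrow> int" where
  "edge_sign E1 E2 e = of_bool (e \<in> E1) - of_bool (e \<in> E2)"

lemma edge_sign_support: "{e. edge_sign E1 E2 e \<noteq> 0} = sym_diff E1 E2"
  by (auto simp: edge_sign_def)

lemma edge_sign_le_1: "\<bar>edge_sign E1 E2 e\<bar> \<le> 1"
  by (auto simp: edge_sign_def)

lemma balanced_parts_finite:
  assumes "balanced_parts F P" "finite {e. F e \<noteq> 0}"
  shows "finite P" "\<And>C. C \<in> P \<Longrightarrow> finite C"
  using assms finite_elements[of "{e. F e \<noteq> 0}" P]
  by (auto simp: balanced_parts_def partition_on_def intro: finite_subset)

lemma balanced_parts_sum_card:
  assumes "balanced_parts F P" "finite {e. F e \<noteq> 0}"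
  shows "card {e. F e \<noteq> 0} = (\<Sum>C\<in>P. card C)"
proof -
  have "card (\<Union>P) = (\<Sum>C\<in>P. card C)"
    by (rule card_Union_disjoint)
      (use assms balanced_parts_finite[OF assms] in \<open>auto simp: balanced_parts_def partition_on_def disjoint_def pairwise_def disjnt_def\<close>)
  then show ?thesis using assms(1) by (auto simp: balanced_parts_def partition_on_def)
qed

lemma balanced_parts_card_le:
  assumes "balanced_parts F P" "finite {e. F e \<noteq> 0}" "F {} = 0"
  shows "2 * card P \<le> card {e. F e \<noteq> 0}"
proof -
  have "2 \<le> card C" if C: "C \<in> P" for C
  proof -
    have sub: "C \<subseteq> {e. F e \<noteq> 0}" "C \<noteq> {}" "\<And>v. vertex_weight F C v = 0"
      using assms C by (auto simp: balanced_parts_def partition_on_def)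
    then obtain e where "e \<in> C" by blast
    moreover have fin: "finite C" using sub assms(2) finite_subset by blast
    ultimately obtain e' where "e' \<in> C" "e' \<noteq> e"
      using balanced_two_edges[of C F e] sub assms(3) by blast
    then have "card {e, e'} \<le> card C" using \<open>e \<in> C\<close> fin by (intro card_mono) auto
    then show ?thesis using \<open>e' \<noteq> e\<close> by simp
  qed
  then have "(\<Sum>C\<in>P. 2) \<le> (\<Sum>C\<in>P. card C)" by (rule sum_mono)
  then show ?thesis using balanced_parts_sum_card[OF assms(1,2)] by simp
qed

text \<open>Tool for both bounds: the restrictions of \<open>F\<close> to the parts, together with
  \<open>g\<close>, form a family for \<open>family_parts\<close>. The function \<open>g\<close> may
  overlap the parts in any way, as long as the total stays within -1 and 1.\<close>

lemma balanced_parts_add: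
  fixes F g :: "'a set \<Rightarrow> int"
  assumes P: "balanced_parts F P" and U: "finite U" "{} \<notin> U"
    and F: "\<And>e. F e \<noteq> 0 \<Longrightarrow> e \<in> U" "\<And>e. \<bar>F e\<bar> \<le> 1"
    and g: "\<And>e. g e \<noteq> 0 \<Longrightarrow> e \<in> U" "\<And>v. vertex_weight g U v = 0"
    and le1: "\<And>e. \<bar>F e + g e\<bar> \<le> 1"
  shows "\<exists>P'. balanced_parts (\<lambda>e. F e + g e) P' \<and>
    int (card {e. F e + g e \<noteq> 0}) - 2 * int (card P')
      \<le> int (card {e. F e \<noteq> 0}) - 2 * int (card P) + cost U g"
proof -
  have finF: "finite {e. F e \<noteq> 0}" by (rule finite_subset[of _ U]) (use F U in auto)
  note fin = balanced_parts_finite[OF P finF]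
  have part: "\<Union>P = {e. F e \<noteq> 0}" "\<And>C D e. C \<in> P \<Longrightarrow> D \<in> P \<Longrightarrow> e \<in> C \<Longrightarrow> e \<in> D \<Longrightarrow> C = D"
    "{} \<notin> P"
    using P by (auto simp: balanced_parts_def partition_on_def disjoint_def)
  define f where "f = (\<lambda>i. case i of None \<Rightarrow> g | Some C \<Rightarrow> (\<lambda>e. if e \<in> C then F e else 0))"
  let ?I = "insert None (Some ` P)"
  have sum: "(\<Sum>i\<in>?I. h i) = h None + (\<Sum>C\<in>P. h (Some C))" for h :: "_ \<Rightarrow> int"
    using fin by (simp add: sum.reindex)
  have sumF: "(\<Sum>C\<in>P. if e \<in> C then F e else 0) = F e" for e
  proof (cases "F e = 0")
    case False
    then obtain C where C: "C \<in> P" "e \<in> C" using part by blast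
    have "(\<Sum>D\<in>P. if e \<in> D then F e else 0) = (\<Sum>D\<in>{C}. if e \<in> D then F e else 0)"
      by (rule sum.mono_neutral_right) (use C fin part(2) in auto)
    then show ?thesis using C by simp
  qed (auto intro: sum.neutral)
  have eq: "(\<Sum>i\<in>?I. f i e) = F e + g e" for e
    unfolding sum using sumF by (simp add: f_def)
  have "cost U (f (Some C)) = int (card C) - 2" if C: "C \<in> P" for C
  proof -
    have CF: "C \<subseteq> {e. F e \<noteq> 0}" using C part(1) by blast
    then have CU: "C \<subseteq> U" "C \<noteq> {}" using C part(3) F(1) by auto
    have "(\<Sum>e\<in>U. \<bar>f (Some C) e\<bar>) = (\<Sum>e\<in>C. 1)"
    proof (rule sum.mono_neutral_cong_right)
      fix e assume "e \<in> C"
      then have "F e \<noteq> 0" using CF by auto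
      then show "\<bar>f (Some C) e\<bar> = 1" using F(2)[of e] \<open>e \<in> C\<close> by (auto simp: f_def)
    qed (use CU U in \<open>auto simp: f_def\<close>)
    then show ?thesis using CF CU by (auto simp: cost_def f_def)
  qed
  then have "(\<Sum>i\<in>?I. cost U (f i)) = cost U g + (\<Sum>C\<in>P. int (card C) - 2)"
    unfolding sum by (simp add: f_def)
  also have "\<dots> = cost U g + int (card {e. F e \<noteq> 0}) - 2 * int (card P)"
    using balanced_parts_sum_card[OF P finF] by (simp add: sum_subtractf)
  finally have c: "(\<Sum>i\<in>?I. cost U (f i)) = cost U g + int (card {e. F e \<noteq> 0}) - 2 * int (card P)" .
  have "\<exists>P. balanced_parts (\<lambda>e. \<Sum>i\<in>?I. f i e) P \<and>
    int (card {e. (\<Sum>i\<in>?I. f i e) \<noteq> 0}) - 2 * int (card P) \<le> (\<Sum>i\<in>?I. cost U (f i))"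
  proof (rule family_parts[OF _ U])
    show "finite ?I" using fin by simp
  next
    fix i e assume "i \<in> ?I" "f i e \<noteq> 0"
    then show "e \<in> U" using g F by (auto simp: f_def split: if_splits)
  next
    fix i v assume i: "i \<in> ?I"
    show "vertex_weight (f i) U v = 0"
    proof (cases i)
      case None
      then show ?thesis using g by (simp add: f_def)
    next
      case (Some C)
      then have C: "C \<in> P" using i by auto
      then have "C \<subseteq> {e. F e \<noteq> 0}" using part(1) by blast
      then have "C \<subseteq> U" using F by auto
      then show ?thesis
        using Some C P U by (simp add: f_def vertex_weight_restrict balanced_parts_def)
    qed
  qed (unfold eq, rule le1)
  then show ?thesis unfolding eq c by (simp add: algebra_simps)
qed

section \<open>Lower bound: undoing swaps one at a time\<close>

lemma finite_two_element_subsets: "finite V \<Longrightarrow> finite {e. e \<subseteq> V \<and> card e = 2}"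
  by (rule finite_subset[of _ "Pow V"]) auto

lemma simple_graph_swap:
  assumes "swap E E'" "simple_graph V E"
  shows "simple_graph V E'"
proof -
  obtain a b c d where "distinct [a, b, c, d]" "{a, c} \<in> E" "{b, d} \<in> E"
    "E' = (E - {{a, c}, {b, d}}) \<union> {{b, c}, {a, d}}"
    using assms(1) unfolding swap_def by blast
  moreover have "{a, c} \<subseteq> V" "{b, d} \<subseteq> V"
    using assms(2) calculation unfolding simple_graph_def by blast+
  ultimately show ?thesis using assms(2) by (auto simp: simple_graph_def)
qed

lemma simple_graph_relpow_swap: "(swap ^^ k) E E' \<Longrightarrow> simple_graph V E \<Longrightarrow> simple_graph V E'"
  by (induction k arbitrary: E') (auto intro: simple_graph_swap)

lemma swap_edge_sign:
  assumes "distinct [a, b, c, d]" "{a, c} \<in> E" "{b, d} \<in> E" "{b, c} \<notin> E" "{a, d} \<notin> E"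
    and "E' = (E - {{a, c}, {b, d}}) \<union> {{b, c}, {a, d}}"
  shows "edge_sign E G e = edge_sign E' G e +
    (of_bool (e = {a, c}) + of_bool (e = {b, d}) - of_bool (e = {b, c}) - of_bool (e = {a, d}))"
proof -
  have "{a, c} \<noteq> {b, d}" "{b, c} \<noteq> {a, d}" using assms(1) by (auto simp: doubleton_eq_iff)
  then show ?thesis using assms(2-) by (auto simp: edge_sign_def)
qed

text \<open>Induction on the number of swaps, peeling off the first one: the partition for the
  remaining swaps absorbs the 4-cycle \<open>g\<close>, at an extra cost of at most 2.\<close>

lemma swap_distance_lower:
  assumes "(swap ^^ k) G1 G2" "simple_graph V G1"
  shows "\<exists>P. balanced_parts (edge_sign G1 G2) P \<and>
    int (card {e. edge_sign G1 G2 e \<noteq> 0}) - 2 * int (card P) \<le> 2 * int k"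
  using assms
proof (induction k arbitrary: G1)
  case 0
  then have "balanced_parts (edge_sign G1 G2) {}"
    by (simp add: balanced_parts_def edge_sign_support partition_on_def)
  then show ?case using 0 by (intro exI[of _ "{}"]) (simp add: edge_sign_support)
next
  case (Suc k)
  from Suc.prems(1) obtain E where E: "swap G1 E" "(swap ^^ k) E G2" by (meson relpowp_Suc_D2)
  have simE: "simple_graph V E" by (rule simple_graph_swap) (use E Suc.prems in auto)
  obtain P where P: "balanced_parts (edge_sign E G2) P"
    "int (card {e. edge_sign E G2 e \<noteq> 0}) - 2 * int (card P) \<le> 2 * int k"
    using Suc.IH[OF E(2) simE] by blast
  have simG2: "simple_graph V G2"
    using simple_graph_relpow_swap[OF E(2) simE] .
  obtain a b c d where sw: "distinct [a, b, c, d]" "{a, c} \<in> G1" "{b, d} \<in> G1" "{b, c} \<notin> G1"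
    "{a, d} \<notin> G1" "E = (G1 - {{a, c}, {b, d}}) \<union> {{b, c}, {a, d}}"
    using E(1) unfolding swap_def by blast
  define U where "U = {e. e \<subseteq> V \<and> card e = 2}"
  define g :: "'a set \<Rightarrow> int" where
    "g = (\<lambda>e. of_bool (e = {a, c}) + of_bool (e = {b, d}) - of_bool (e = {b, c}) - of_bool (e = {a, d}))"
  have U: "finite U" "{} \<notin> U"
    using Suc.prems(2) by (auto simp: U_def simple_graph_def finite_two_element_subsets)
  have inU: "{a, c} \<in> U" "{b, d} \<in> U" "{b, c} \<in> U" "{a, d} \<in> U"
    using sw(2,3,6) simE Suc.prems(2) unfolding U_def simple_graph_def by blast+
  have eq: "edge_sign G1 G2 e = edge_sign E G2 e + g e" for e
    unfolding g_def by (rule swap_edge_sign[OF sw])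
  \<comment> \<open>Bounding by four separate indicators avoids telling the four pairs apart; the
    factors \<open>1\<close> match the form of \<open>sum_of_bool_single\<close>.\<close>
  have "(\<Sum>e\<in>U. \<bar>g e\<bar>) \<le> (\<Sum>e\<in>U. of_bool (e = {a, c}) * 1 + of_bool (e = {b, d}) * 1 +
      of_bool (e = {b, c}) * 1 + of_bool (e = {a, d}) * 1)"
    by (rule sum_mono) (auto simp: g_def)
  also have "\<dots> = 4" unfolding sum.distrib sum_of_bool_single[OF U(1) inU(1)]
    sum_of_bool_single[OF U(1) inU(2)] sum_of_bool_single[OF U(1) inU(3)] sum_of_bool_single[OF U(1) inU(4)] by simp
  finally have cost: "cost U g \<le> 2" by (simp add: cost_def)
  have gw: "vertex_weight g U v = 0" for v
  proof -
    have "vertex_weight g U v = (\<Sum>e\<in>U. of_bool (e = {a, c}) * of_bool (v \<in> e)) +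
      (\<Sum>e\<in>U. of_bool (e = {b, d}) * of_bool (v \<in> e)) -
      (\<Sum>e\<in>U. of_bool (e = {b, c}) * of_bool (v \<in> e)) -
      (\<Sum>e\<in>U. of_bool (e = {a, d}) * of_bool (v \<in> e))"
      unfolding vertex_weight_def g_def by (simp only: ring_distribs sum.distrib sum_subtractf)
    also have "\<dots> = of_bool (v \<in> {a, c}) + of_bool (v \<in> {b, d}) - of_bool (v \<in> {b, c}) - of_bool (v \<in> {a, d})"
      unfolding sum_of_bool_single[OF U(1) inU(1)] sum_of_bool_single[OF U(1) inU(2)]
        sum_of_bool_single[OF U(1) inU(3)] sum_of_bool_single[OF U(1) inU(4)] ..
    also have "\<dots> = 0" using sw(1) by auto
    finally show ?thesis .
  qed
  have "e \<in> U" if "edge_sign E G2 e \<noteq> 0" for e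
  proof -
    have "e \<in> E \<or> e \<in> G2" using that by (auto simp: edge_sign_def)
    then show ?thesis using simE simG2 unfolding U_def simple_graph_def by blast
  qed
  moreover have "e \<in> U" if "g e \<noteq> 0" for e
  proof (rule ccontr)
    assume "e \<notin> U"
    then have "e \<noteq> {a, c}" "e \<noteq> {b, d}" "e \<noteq> {b, c}" "e \<noteq> {a, d}" using inU by metis+
    then show False using that by (simp add: g_def)
  qed
  ultimately have "\<exists>P'. balanced_parts (\<lambda>e. edge_sign E G2 e + g e) P' \<and>
    int (card {e. edge_sign E G2 e + g e \<noteq> 0}) - 2 * int (card P')
      \<le> int (card {e. edge_sign E G2 e \<noteq> 0}) - 2 * int (card P) + cost U g"
    by (intro balanced_parts_add[OF P(1) U]) (auto simp: gw edge_sign_le_1 eq[symmetric])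
  then show ?case using P(2) cost unfolding eq[symmetric] by (smt (verit) of_nat_Suc)
qed

section \<open>Alternating trails\<close>

text \<open>The rest \<open>C - D\<close> is balanced by subtraction, so \<open>C\<close> splits in
  two. Consequently the parts of a partition of maximum size are minimal balanced sets.\<close>

lemma balanced_parts_refine:
  assumes P: "balanced_parts F P" and fin: "finite {e. F e \<noteq> 0}"
    and D: "C \<in> P" "D \<subset> C" "D \<noteq> {}" "\<And>v. vertex_weight F D v = 0"
  shows "\<exists>P'. balanced_parts F P' \<and> card P' = Suc (card P)"
proof (intro exI conjI)
  let ?P = "insert D (insert (C - D) (P - {C}))"
  note finP = balanced_parts_finite[OF P fin]
  have part: "\<Union>P = {e. F e \<noteq> 0}" "\<And>A B. A \<in> P \<Longrightarrow> B \<in> P \<Longrightarrow> A \<noteq> B \<Longrightarrow> A \<inter> B = {}"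
    "{} \<notin> P" "\<And>A v. A \<in> P \<Longrightarrow> vertex_weight F A v = 0"
    using P by (auto simp: balanced_parts_def partition_on_def disjoint_def)
  have C: "D \<union> (C - D) = C" "finite C" using D finP by auto
  have "vertex_weight F (D \<union> (C - D)) v = vertex_weight F D v + vertex_weight F (C - D) v" for v
    by (rule vertex_weight_Un) (use C finite_subset D in auto)
  then have CD: "vertex_weight F (C - D) v = 0" for v
    using part(4)[OF D(1)] D(4) C(1) by simp
  have other: "A \<inter> C = {}" if "A \<in> P - {C}" for A using that part(2) D(1) by blast
  have "partition_on {e. F e \<noteq> 0} ?P"
  proof (rule partition_onI)
    have "\<Union>?P = C \<union> \<Union>(P - {C})" using C(1) by auto
    also have "\<dots> = \<Union>P" using D(1) by blast
    finally show "\<Union>?P = {e. F e \<noteq> 0}" using part(1) by simp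
    have "A \<inter> B = {}" if "A \<in> P - {C}" "B \<in> P - {C}" "A \<noteq> B" for A B
      using part(2) that by blast
    moreover have "A \<inter> D = {}" "A \<inter> (C - D) = {}" if "A \<in> P - {C}" for A
      using other[OF that] D(2) by blast+
    moreover have "D \<inter> (C - D) = {}" by blast
    ultimately show "disjnt A B" if "A \<in> ?P" "B \<in> ?P" "A \<noteq> B" for A B
      using that unfolding disjnt_def insert_iff by (metis Int_commute)
    show "{} \<notin> ?P" using part(3) D by blast
  qed
  then show "balanced_parts F ?P"
    using part(4) CD D(4) by (auto simp: balanced_parts_def)
  have "D \<notin> insert (C - D) (P - {C})" "C - D \<notin> P - {C}"
    using other D by blast+
  then show "card ?P = Suc (card P)"
    using card_Suc_Diff1[OF finP(1) D(1)] finP(1) by (metis card_insert_disjoint finite_Diff finite_insert)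
qed

text \<open>Trails are functions on indices with a separate length, so that segments become images
  of index intervals and rotations become index shifts.\<close>

definition step :: "(nat \<Rightarrow> 'a) \<Rightarrow> nat \<Rightarrow> 'a set" where
  "step u i = {u i, u (Suc i)}"

text \<open>The parameter \<open>s\<close> is the sign of the first edge.\<close>

definition alt_trail :: "('a set \<Rightarrow> int) \<Rightarrow> int \<Rightarrow> (nat \<Rightarrow> 'a) \<Rightarrow> nat \<Rightarrow> bool" where
  "alt_trail F s u n \<longleftrightarrow> inj_on (step u) {..<n} \<and>
     (\<forall>i<n. u i \<noteq> u (Suc i) \<and> F (step u i) = s * (-1) ^ i)"

text \<open>The sum telescopes: inner visits enter by one sign and leave by the other. Whether a
  union of disjoint segments is balanced thus depends only on their endpoints and the parities of
  the indices.\<close>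

lemma alt_trail_segment_weight:
  assumes "alt_trail F s u n" "a \<le> b" "b \<le> n"
  shows "vertex_weight F (step u ` {a..<b}) v =
    s * ((-1) ^ a * of_bool (v = u a) - (-1) ^ b * of_bool (v = u b))"
proof -
  let ?h = "\<lambda>i. s * (-1) ^ i * of_bool (v = u i)"
  have "inj_on (step u) {a..<b}"
    using assms unfolding alt_trail_def by (auto intro: inj_on_subset)
  then have "vertex_weight F (step u ` {a..<b}) v = (\<Sum>i\<in>{a..<b}. F (step u i) * of_bool (v \<in> step u i))"
    unfolding vertex_weight_def by (simp only: sum.reindex o_def)
  also have "\<dots> = (\<Sum>i\<in>{a..<b}. ?h i - ?h (Suc i))"
  proof (rule sum.cong)
    fix i assume "i \<in> {a..<b}"
    then have "u i \<noteq> u (Suc i)" "F (step u i) = s * (-1) ^ i"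
      using assms by (auto simp: alt_trail_def)
    then show "F (step u i) * of_bool (v \<in> step u i) = ?h i - ?h (Suc i)"
      by (auto simp: step_def)
  qed simp
  also have "\<dots> = - (\<Sum>i\<in>{a..<b}. ?h (Suc i) - ?h i)"
    by (simp only: sum_negf[symmetric] minus_diff_eq)
  also have "\<dots> = ?h a - ?h b"
    by (simp only: sum_Suc_diff'[OF assms(2), of ?h] minus_diff_eq)
  finally show ?thesis by (simp add: algebra_simps)
qed

lemma vertex_weight_sign_edge:
  assumes "t * vertex_weight F S v > 0"
  shows "\<exists>e\<in>S. v \<in> e \<and> t * F e > 0"
proof (rule ccontr)
  assume "\<not> ?thesis"
  then have "(\<Sum>e\<in>S. t * (F e * of_bool (v \<in> e))) \<le> 0" by (intro sum_nonpos) force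
  then show False using assms by (simp add: vertex_weight_def sum_distrib_left)
qed

text \<open>A trail that is not closed leaves an edge of the next colour unused at its end.\<close>

lemma closed_alt_trail_exists:
  assumes fin: "finite C" and card2: "\<And>e. e \<in> C \<Longrightarrow> card e = 2"
    and sign: "\<And>e. e \<in> C \<Longrightarrow> F e = 1 \<or> F e = - 1"
    and bal: "\<And>v. vertex_weight F C v = 0" and "C \<noteq> {}"
  shows "\<exists>u n. n > 0 \<and> even n \<and> u n = u 0 \<and> alt_trail F 1 u n \<and> step u ` {..<n} \<subseteq> C"
proof (rule ccontr)
  assume no: "\<not> ?thesis"
  \<comment> \<open>If no trail closes, every trail can be prolonged, and \<open>C\<close> would
    contain a trail with more than \<open>card C\<close> edges.\<close>
  have "\<exists>u. alt_trail F 1 u (Suc n) \<and> step u ` {..<Suc n} \<subseteq> C" for n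
  proof (induction n)
    case 0
    have "\<exists>e\<in>C. F e = 1"
    proof (rule ccontr)
      assume neg: "\<not> ?thesis"
      then have neg: "F e = - 1" if "e \<in> C" for e using sign that by blast
      obtain e where e: "e \<in> C" using \<open>C \<noteq> {}\<close> by blast
      then obtain v where v: "v \<in> e" using card2 by fastforce
      have "(\<Sum>e\<in>C. - (F e * of_bool (v \<in> e))) > 0"
        by (rule sum_pos2[OF fin e]) (use neg e v in auto)
      then show False using bal[of v] by (simp add: vertex_weight_def sum_negf)
    qed
    then obtain e where e: "e \<in> C" "F e = 1" by blast
    then obtain x y where xy: "e = {x, y}" "x \<noteq> y" using card2 by (meson card_2_iff)
    have "alt_trail F 1 (\<lambda>i. if i = 0 then x else y) (Suc 0)"
      using e xy by (simp add: alt_trail_def step_def lessThan_Suc)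
    moreover have "step (\<lambda>i. if i = 0 then x else y) ` {..<Suc 0} \<subseteq> C"
      using e xy by (auto simp: step_def)
    ultimately show ?case by blast
  next
    case (Suc m)
    define n where "n = Suc m"
    have "n > 0" by (simp add: n_def)
    obtain u where u: "alt_trail F 1 u n" "step u ` {..<n} \<subseteq> C"
      using Suc by (auto simp: n_def)
    let ?S = "step u ` {..<n}"
    have "vertex_weight F (?S \<union> (C - ?S)) (u n) =
        vertex_weight F ?S (u n) + vertex_weight F (C - ?S) (u n)"
      by (rule vertex_weight_Un) (use fin in auto)
    moreover have "?S \<union> (C - ?S) = C" using u(2) by blast
    moreover have "vertex_weight F ?S (u n) = of_bool (u n = u 0) - (-1) ^ n"
      using alt_trail_segment_weight[OF u(1), of 0 n "u n"] by (simp add: atLeast0LessThan)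
    ultimately have "vertex_weight F (C - ?S) (u n) = (-1) ^ n - of_bool (u n = u 0)"
      using bal[of "u n"] by simp
    \<comment> \<open>Times \<open>(-1) ^ n\<close>, the remaining weight is
      \<open>1 - (-1) ^ n * of_bool (u n = u 0)\<close>. It vanishes only for a return to the start
      after an even number of edges; a return after an odd number leaves the trail open.\<close>
    moreover have "\<not> (even n \<and> u n = u 0)" using no u \<open>n > 0\<close> by blast
    ultimately have "(-1) ^ n * vertex_weight F (C - ?S) (u n) > 0"
      by (cases "even n"; cases "u n = u 0") auto
    then obtain e where e: "e \<in> C - ?S" "u n \<in> e" "(-1) ^ n * F e > 0"
      using vertex_weight_sign_edge[of "(-1) ^ n" F "C - ?S" "u n"] by blast
    then have Fe: "F e = (-1) ^ n" using sign[of e] by (cases "even n") auto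
    obtain w where w: "e = {u n, w}" "w \<noteq> u n"
      using card2[of e] e(1,2) by (auto simp: card_2_iff)
    define u' where "u' = u(Suc n := w)"
    have old: "step u' i = step u i" "u' i = u i" "u' (Suc i) = u (Suc i)" if "i < n" for i
      using that by (auto simp: u'_def step_def)
    have new: "step u' n = e" using w by (simp add: u'_def step_def)
    have img: "step u' ` {..<n} = ?S" using old by (intro image_cong) auto
    have lt: "{..<Suc n} = insert n {..<n}" by auto
    have "inj_on (step u') {..<n}"
      using u(1) old by (simp add: alt_trail_def inj_on_def)
    then have "inj_on (step u') {..<Suc n}"
      using e(1) img new unfolding lt by (auto simp: inj_on_insert)
    moreover have "u' i \<noteq> u' (Suc i) \<and> F (step u' i) = 1 * (-1) ^ i" if "i < Suc n" for i
    proof (cases "i = n")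
      case True
      then show ?thesis using new Fe w by (simp add: u'_def)
    next
      case False
      then show ?thesis using that old[of i] u(1) by (simp add: alt_trail_def)
    qed
    ultimately have "alt_trail F 1 u' (Suc n)" by (simp add: alt_trail_def)
    moreover have "step u' ` {..<Suc n} \<subseteq> C" unfolding lt using img new e u(2) by auto
    ultimately show ?case unfolding n_def by blast
  qed
  then obtain u where "alt_trail F 1 u (Suc (card C))" "step u ` {..<Suc (card C)} \<subseteq> C" by blast
  then have "Suc (card C) \<le> card C"
    using card_mono[OF fin, of "step u ` {..<Suc (card C)}"] by (simp add: alt_trail_def card_image)
  then show False by simp
qed

text \<open>
  In a minimal balanced set, repeated vertices lie at odd distance along the trail, and two
  repetitions never interleave, because the segments \<open>[a, b]\<close> and \<open>[c, d]\<close> would form a balanced set.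
  The interior of a shortest segment between repetitions thus consists of vertices visited once.
\<close>

lemma minimal_closed_trail_vertex_once:
  assumes tr: "alt_trail F s u n" and n: "n > 0"
    and min: "\<And>D. D \<subset> step u ` {..<n} \<Longrightarrow> D \<noteq> {} \<Longrightarrow> \<exists>v. vertex_weight F D v \<noteq> 0"
  shows "\<exists>m<n. even m \<and> (\<forall>k<n. u k = u m \<longrightarrow> k = m)"
proof (cases "\<exists>i j. i < j \<and> j < n \<and> u i = u j")
  case False
  then show ?thesis using n by (intro exI[of _ 0]) (auto, metis gr0I)
next
  case True
  have inj: "inj_on (step u) {..<n}" using tr by (simp add: alt_trail_def)
  have proper: "step u ` A \<subset> step u ` {..<n}" if "A \<subseteq> {..<n}" "b < n" "b \<notin> A" for A b
  proof -
    have "step u b \<notin> step u ` A" using inj that by (auto dest: inj_onD)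
    then show ?thesis using that by blast
  qed
  \<comment> \<open>At even distance the segment between the two visits would be balanced by itself,
    and it misses edge number \<open>j\<close>.\<close>
  have odd_rep: "odd (j - i)" if ij: "i < j" "j < n" "u i = u j" for i j
  proof (rule ccontr)
    assume "\<not> odd (j - i)"
    then have "even i \<longleftrightarrow> even j" using ij by auto
    then have "vertex_weight F (step u ` {i..<j}) v = 0" for v
    proof -
      have "vertex_weight F (step u ` {i..<j}) v = s * ((-1) ^ i * of_bool (v = u i) - (-1) ^ j * of_bool (v = u j))"
        by (rule alt_trail_segment_weight[OF tr]; use ij in simp)
      moreover have "(-1) ^ i = ((-1) ^ j :: int)"
        using \<open>even i \<longleftrightarrow> even j\<close> by (cases "even i") simp_all
      ultimately show ?thesis by (simp only: ij(3) diff_self mult_zero_right)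
    qed
    moreover have "step u ` {i..<j} \<subset> step u ` {..<n}"
      by (rule proper[of _ j]) (use ij in auto)
    from min[OF this] have "\<exists>v. vertex_weight F (step u ` {i..<j}) v \<noteq> 0" using ij by simp
    ultimately show False by simp
  qed
  have crossing: False
    if abcd: "a < b" "b < c" "c < d" "d < n" "u a = u c" "u b = u d" for a b c d
  proof -
    let ?A = "step u ` {a..<b}" and ?B = "step u ` {c..<d}"
    have "vertex_weight F (?A \<union> ?B) v = vertex_weight F ?A v + vertex_weight F ?B v" for v
    proof (rule vertex_weight_Un)
      show "?A \<inter> ?B = {}"
        using abcd inj by (subst inj_on_image_Int[of _ "{..<n}", symmetric]) auto
    qed auto
    moreover
    \<comment> \<open>Odd distances reverse the signs at \<open>c\<close> and \<open>d\<close>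
      relative to \<open>a\<close> and \<open>b\<close>, so the endpoint terms of the two segments
      cancel.\<close>
    have "odd (c - a)" "odd (d - b)"
      using odd_rep[of a c] odd_rep[of b d] abcd by auto
    then have "even c \<longleftrightarrow> odd a" "even d \<longleftrightarrow> odd b" using abcd by auto
    then have sg: "(-1) ^ c = - ((-1) ^ a :: int)" "(-1) ^ d = - ((-1) ^ b :: int)"
      by (cases "even a"; cases "even b"; simp)+
    have "vertex_weight F ?A v + vertex_weight F ?B v = 0" for v
    proof -
      have "vertex_weight F ?A v = s * ((-1) ^ a * of_bool (v = u a) - (-1) ^ b * of_bool (v = u b))"
        "vertex_weight F ?B v = s * ((-1) ^ c * of_bool (v = u c) - (-1) ^ d * of_bool (v = u d))"
        by (rule alt_trail_segment_weight[OF tr]; use abcd in simp)+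
      then show ?thesis unfolding sg abcd(5,6) by (simp add: algebra_simps)
    qed
    moreover have "?A \<union> ?B \<subset> step u ` {..<n}"
      unfolding image_Un[symmetric] by (rule proper[of _ b]) (use abcd in auto)
    from min[OF this] have "\<exists>v. vertex_weight F (?A \<union> ?B) v \<noteq> 0" using abcd by simp
    ultimately show False by simp
  qed
  define d where "d = (LEAST d. d > 0 \<and> (\<exists>i. i + d < n \<and> u i = u (i + d)))"
  have ex: "\<exists>d. d > 0 \<and> (\<exists>i. i + d < n \<and> u i = u (i + d))"
    using True by (metis less_imp_add_positive)
  have "d > 0 \<and> (\<exists>i. i + d < n \<and> u i = u (i + d))"
    unfolding d_def using ex by (rule LeastI_ex)
  then obtain i where i: "d > 0" "i + d < n" "u i = u (i + d)" by blast
  have least: "d \<le> k - j" if "j < k" "k < n" "u j = u k" for j k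
    unfolding d_def by (rule Least_le) (use that in \<open>auto intro!: exI[of _ j]\<close>)
  have "odd d" using odd_rep[of i "i + d"] i by simp
  moreover have "d \<noteq> 1"
  proof
    assume "d = 1"
    then have "i < n" "u i = u (Suc i)" using i by simp_all
    then show False using tr unfolding alt_trail_def by blast
  qed
  ultimately have d3: "d \<ge> 3" by presburger
  \<comment> \<open>Since \<open>d \<ge> 3\<close>, both \<open>i + 1\<close> and
    \<open>i + 2\<close> are interior to the segment. The even one is chosen so that restarting the
    trail there keeps the sign of the first edge.\<close>
  define m where "m = (if even i then i + 2 else i + 1)"
  have m: "even m" "i < m" "m < i + d" using d3 by (auto simp: m_def)
  have "k = m" if k: "k < n" "u k = u m" for k
  proof (rule ccontr)
    assume "k \<noteq> m"
    \<comment> \<open>Outside the segment, a second visit would interleave with \<open>i\<close> and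
      \<open>i + d\<close>; inside, it would be a repetition at distance below
      \<open>d\<close>.\<close>
    then consider "k < i" | "i \<le> k" "k < m" | "m < k" "k \<le> i + d" | "i + d < k" by linarith
    then show False
    proof cases
      case 1
      show False by (rule crossing[of k i m "i + d"]) (fact 1 m k i)+
    next
      case 2
      have "d \<le> m - k" by (rule least) (use 2 k i m in linarith, use 2 k i m in linarith, fact k(2))
      then show False using 2 m by linarith
    next
      case 3
      have "d \<le> k - m" by (rule least) (fact 3 k(1) k(2)[symmetric])+
      then show False using 3 m by linarith
    next
      case 4
      show False by (rule crossing[of i m "i + d" k]) (fact 4 m k(1) i k(2)[symmetric])+
    qed
  qed
  then show ?thesis using m i by (intro exI[of _ m]) auto
qed

lemma shift_mod_inj:
  fixes m n i j :: nat
  assumes "(m + i) mod n = (m + j) mod n" "m < n" "i < n" "j < n"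
  shows "i = j"
proof -
  have "(m + k) mod n = (if m + k < n then m + k else m + k - n)" if "k < n" for k
    using that assms(2) by (auto simp: not_less le_mod_geq)
  then show ?thesis using assms by (auto split: if_splits)
qed

text \<open>An even offset preserves the signs, and because \<open>n\<close> is even, reduction
  modulo \<open>n\<close> preserves parity at the wraparound.\<close>

lemma alt_trail_rotate:
  assumes tr: "alt_trail F s u n" and n: "even n" "u n = u 0" and m: "even m" "m < n"
  shows "alt_trail F s (\<lambda>i. u ((m + i) mod n)) n"
    and "step (\<lambda>i. u ((m + i) mod n)) ` {..<n} \<subseteq> step u ` {..<n}"
proof -
  let ?w = "\<lambda>i. u ((m + i) mod n)"
  have lt: "(m + i) mod n < n" for i using m by simp
  have suc: "?w (Suc i) = u (Suc ((m + i) mod n))" for i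
    using n(2) by (auto simp: mod_Suc)
  have st: "step ?w i = step u ((m + i) mod n)" for i
    unfolding step_def suc ..
  have "(-1) ^ ((m + i) mod n) = ((-1) ^ i :: int)" for i
  proof -
    have "even ((m + i) mod n) \<longleftrightarrow> even i" using n m by (simp add: dvd_mod_iff)
    then show ?thesis by (cases "even i") auto
  qed
  moreover have "inj_on (step ?w) {..<n}"
  proof (rule inj_onI)
    fix i j assume ij: "i \<in> {..<n}" "j \<in> {..<n}" "step ?w i = step ?w j"
    then have "(m + i) mod n = (m + j) mod n"
      using tr lt unfolding st alt_trail_def by (auto dest: inj_onD)
    then show "i = j" using ij m(2) by (auto intro: shift_mod_inj)
  qed
  ultimately show "alt_trail F s ?w n"
    using tr lt unfolding alt_trail_def suc st by simp
  show "step ?w ` {..<n} \<subseteq> step u ` {..<n}" unfolding st using lt by auto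
qed

text \<open>A closed alternating trail inside \<open>C\<close> is balanced, so minimality makes it
  use all of \<open>C\<close>. Rotating it to a vertex visited once yields the last clause, from
  which \<open>swap_step\<close> gets four different vertices.\<close>

lemma minimal_balanced_closed_trail:
  assumes fin: "finite C" and card2: "\<And>e. e \<in> C \<Longrightarrow> card e = 2"
    and sign: "\<And>e. e \<in> C \<Longrightarrow> F e = 1 \<or> F e = - 1"
    and bal: "\<And>v. vertex_weight F C v = 0" and "C \<noteq> {}"
    and min: "\<And>D. D \<subset> C \<Longrightarrow> D \<noteq> {} \<Longrightarrow> \<exists>v. vertex_weight F D v \<noteq> 0"
  shows "\<exists>u n. n > 0 \<and> even n \<and> u n = u 0 \<and> alt_trail F 1 u n \<and> step u ` {..<n} = C \<and>
    (\<forall>k. 0 < k \<and> k < n \<longrightarrow> u k \<noteq> u 0)"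
proof -
  have all: "step u ` {..<n} = C"
    if "n > 0" "even n" "u n = u 0" "alt_trail F 1 u n" "step u ` {..<n} \<subseteq> C" for u n
  proof (rule ccontr)
    assume "step u ` {..<n} \<noteq> C"
    moreover have "vertex_weight F (step u ` {..<n}) v = 0" for v
      using alt_trail_segment_weight[OF that(4), of 0 n v] that by (simp add: atLeast0LessThan)
    moreover have "step u ` {..<n} \<noteq> {}" using that(1) by auto
    ultimately show False using min that(5) by blast
  qed
  obtain u n where u: "n > 0" "even n" "u n = u 0" "alt_trail F 1 u n" "step u ` {..<n} \<subseteq> C"
    using closed_alt_trail_exists[of C F] fin card2 sign bal \<open>C \<noteq> {}\<close> by blast
  obtain m where m: "m < n" "even m" "\<forall>k<n. u k = u m \<longrightarrow> k = m"
    using minimal_closed_trail_vertex_once[OF u(4,1)] min all[OF u] by blast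
  let ?w = "\<lambda>i. u ((m + i) mod n)"
  have w: "alt_trail F 1 ?w n" "step ?w ` {..<n} \<subseteq> C" "?w n = ?w 0"
    using alt_trail_rotate[OF u(4,2,3) m(2,1)] u(5) by auto
  have "?w k \<noteq> ?w 0" if "0 < k" "k < n" for k
  proof
    assume "?w k = ?w 0"
    then have "(m + k) mod n = m" using m u(1) by auto
    then show False using shift_mod_inj[of m k n 0] m(1) that by simp
  qed
  then show ?thesis using u(1,2) w all[OF u(1,2) w(3,1,2)] by (intro exI[of _ ?w] exI[of _ n]) auto
qed

section \<open>Reducing the distance by a swap\<close>

lemma balanced_parts_remove:
  assumes "balanced_parts F P" "C \<in> P"
  shows "balanced_parts (\<lambda>e. if e \<in> C then 0 else F e) (P - {C})"
proof -
  have part: "\<Union>P = {e. F e \<noteq> 0}" "\<And>A B. A \<in> P \<Longrightarrow> B \<in> P \<Longrightarrow> A \<noteq> B \<Longrightarrow> A \<inter> B = {}"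
    "{} \<notin> P" "\<And>A v. A \<in> P \<Longrightarrow> vertex_weight F A v = 0"
    using assms(1) by (auto simp: balanced_parts_def partition_on_def disjoint_def)
  have other: "A \<inter> C = {}" if "A \<in> P - {C}" for A using that part(2) assms(2) by blast
  have "\<Union>(P - {C}) = \<Union>P - C" using other assms(2) by blast
  then have "\<Union>(P - {C}) = {e. (if e \<in> C then 0 else F e) \<noteq> 0}" using part(1) by auto
  moreover have "vertex_weight (\<lambda>e. if e \<in> C then 0 else F e) A v = 0" if "A \<in> P - {C}" for A v
  proof -
    have "vertex_weight (\<lambda>e. if e \<in> C then 0 else F e) A v = vertex_weight F A v"
      unfolding vertex_weight_def by (rule sum.cong) (use other[OF that] in auto)
    then show ?thesis using part(4) that by simp
  qed
  ultimately show ?thesis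
    using part(2,3) by (auto simp: balanced_parts_def partition_on_def disjoint_def)
qed

lemma vertex_weight_restrict_edge:
  assumes "finite U" "X \<subseteq> U" "p \<in> U"
  shows "vertex_weight (\<lambda>e. (if e \<in> X then F e else 0) + t * of_bool (e = p)) U v =
    vertex_weight F X v + t * of_bool (v \<in> p)"
proof -
  have "vertex_weight (\<lambda>e. t * of_bool (e = p)) U v = (\<Sum>e\<in>U. of_bool (e = p) * (t * of_bool (v \<in> e)))"
    unfolding vertex_weight_def by (simp only: mult_ac)
  also have "\<dots> = t * of_bool (v \<in> p)" by (rule sum_of_bool_single) (use assms in auto)
  finally show ?thesis
    using vertex_weight_restrict[OF assms(1,2)] by (simp only: vertex_weight_add)
qed

text \<open>Price of closing a segment \<open>X\<close> by a chord \<open>p\<close>. This is only an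
  upper bound, since \<open>p\<close> may itself be an edge of \<open>X\<close> and cancel
  there.\<close>

lemma cost_restrict_edge:
  assumes U: "finite U" "X \<subseteq> U" "p \<in> U" "X \<noteq> {}"
    and F: "\<And>e. \<bar>F e\<bar> \<le> 1" and t: "\<bar>t\<bar> = 1"
  shows "cost U (\<lambda>e. (if e \<in> X then F e else 0) + t * of_bool (e = p)) \<le> int (card X) - 1"
proof -
  have fin: "finite X" using U finite_subset by blast
  have "(\<Sum>e\<in>U. \<bar>(if e \<in> X then F e else 0) + t * of_bool (e = p)\<bar>) \<le>
      (\<Sum>e\<in>U. of_bool (e \<in> X) + of_bool (e = p) * 1)"
  proof (rule sum_mono)
    fix e
    have "\<bar>(if e \<in> X then F e else 0) + t * of_bool (e = p)\<bar> \<le>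
        \<bar>if e \<in> X then F e else 0\<bar> + \<bar>t * of_bool (e = p)\<bar>" by (rule abs_triangle_ineq)
    also have "\<dots> \<le> of_bool (e \<in> X) + of_bool (e = p) * 1" using F[of e] t by (auto simp: abs_mult)
    finally show "\<bar>(if e \<in> X then F e else 0) + t * of_bool (e = p)\<bar> \<le>
        of_bool (e \<in> X) + of_bool (e = p) * 1" .
  qed
  also have "\<dots> = (\<Sum>e\<in>U. of_bool (e \<in> X)) + (\<Sum>e\<in>U. of_bool (e = p) * 1)"
    by (rule sum.distrib)
  also have "(\<Sum>e\<in>U. of_bool (e = p) * 1) = (1 :: int)"
    by (rule sum_of_bool_single) (use U in auto)
  also have "(\<Sum>e\<in>U. of_bool (e \<in> X)) = (\<Sum>e\<in>X. (1 :: int))"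
    by (rule sum.mono_neutral_cong_right) (use U in auto)
  finally have "(\<Sum>e\<in>U. \<bar>(if e \<in> X then F e else 0) + t * of_bool (e = p)\<bar>) \<le> int (card X) + 1"
    by simp
  \<comment> \<open>Covers the case that the function vanishes and costs 0.\<close>
  moreover have "card X \<ge> 1" using fin U(4) by (simp add: Suc_leI card_gt_0_iff)
  ultimately show ?thesis unfolding cost_def by auto
qed

lemma last_true_before_false:
  fixes T :: "nat \<Rightarrow> bool"
  shows "T 0 \<Longrightarrow> \<not> T k \<Longrightarrow> \<exists>j<k. T j \<and> \<not> T (Suc j)"
  by (induction k) (auto intro: less_SucI)

text \<open>
  Along the trail \<open>u\<close>, the pair \<open>{u 0, u 1}\<close> is an edge of \<open>G1\<close> and \<open>{u 0, u (n - 1)}\<close> is not. At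
  the index \<open>k\<close> where this changes, the vertices \<open>u 0\<close>, \<open>u k\<close>, \<open>u (k + 1)\<close>, \<open>u (k + 2)\<close> allow a swap;
  the chords \<open>{u 0, u k}\<close> and \<open>{u 0, u (k + 2)}\<close> close the two remaining segments of the trail to
  balanced sets.
\<close>

lemma swap_step:
  assumes simp1: "simple_graph V G1" and simp2: "simple_graph V G2"
    and P: "balanced_parts (edge_sign G1 G2) P" and C: "C \<in> P"
    and min: "\<And>D. D \<subset> C \<Longrightarrow> D \<noteq> {} \<Longrightarrow> \<exists>v. vertex_weight (edge_sign G1 G2) D v \<noteq> 0"
  shows "\<exists>G P'. swap G1 G \<and> balanced_parts (edge_sign G G2) P' \<and>
    int (card {e. edge_sign G G2 e \<noteq> 0}) - 2 * int (card P') \<le>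
    int (card {e. edge_sign G1 G2 e \<noteq> 0}) - 2 * int (card P) - 2"
proof -
  define F where "F = edge_sign G1 G2"
  define U where "U = {e. e \<subseteq> V \<and> card e = 2}"
  have U: "finite U" "{} \<notin> U"
    using simp1 by (auto simp: U_def simple_graph_def finite_two_element_subsets)
  have G12: "G1 \<subseteq> U" "G2 \<subseteq> U" using simp1 simp2 by (auto simp: U_def simple_graph_def)
  have FU: "e \<in> U" if "F e \<noteq> 0" for e
    using that G12 by (auto simp: F_def edge_sign_def of_bool_def split: if_splits)
  have finF: "finite {e. F e \<noteq> 0}" by (rule finite_subset[OF _ U(1)]) (use FU in auto)
  have P': "balanced_parts F P" using P by (simp add: F_def)
  note finP = balanced_parts_finite[OF P' finF]
  have part: "\<Union>P = {e. F e \<noteq> 0}" "{} \<notin> P" "\<And>A v. A \<in> P \<Longrightarrow> vertex_weight F A v = 0"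
    using P' by (auto simp: balanced_parts_def partition_on_def)
  have CF: "C \<subseteq> {e. F e \<noteq> 0}" using part(1) C by blast
  have "\<exists>u n. n > 0 \<and> even n \<and> u n = u 0 \<and> alt_trail F 1 u n \<and> step u ` {..<n} = C \<and>
      (\<forall>k. 0 < k \<and> k < n \<longrightarrow> u k \<noteq> u 0)"
  proof (rule minimal_balanced_closed_trail)
    fix e assume "e \<in> C"
    then have "F e \<noteq> 0" using CF by auto
    then show "card e = 2" "F e = 1 \<or> F e = - 1"
      using FU[of e] by (auto simp: U_def F_def edge_sign_def)
  qed (use finP(2) C part min[folded F_def] in auto)
  then obtain u n where n: "n > 0" "even n" "u n = u 0" and tr: "alt_trail F 1 u n"
    and stepC: "step u ` {..<n} = C" and once: "\<And>k. 0 < k \<Longrightarrow> k < n \<Longrightarrow> u k \<noteq> u 0"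
    by blast
  have inj: "inj_on (step u) {..<n}" using tr by (simp add: alt_trail_def)
  have Fst: "F (step u i) = (-1) ^ i" "u i \<noteq> u (Suc i)" if "i < n" for i
    using tr that by (auto simp: alt_trail_def)
  obtain l where l: "n = 2 * l" using n(2) by blast
  have "l > 0" using l n(1) by simp
  \<comment> \<open>Odd indices only: the first and last edges join \<open>u 0\<close> to
    \<open>u 1\<close> and \<open>u (n - 1)\<close>, and an odd \<open>k\<close> makes edges
    \<open>k\<close> and \<open>k + 1\<close> blue and red. Membership is tested in
    \<open>G1\<close> alone; the chords may or may not belong to \<open>G2\<close>.\<close>
  let ?T = "\<lambda>j. {u 0, u (2 * j + 1)} \<in> G1"
  have "?T 0"
    using Fst(1)[of 0] n(1) by (auto simp: F_def edge_sign_def step_def of_bool_def split: if_splits)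
  moreover have "\<not> ?T (l - 1)"
  proof -
    have "2 * (l - 1) + 1 = n - 1" using l \<open>l > 0\<close> by linarith
    moreover have "Suc (n - 1) = n" using n(1) by simp
    moreover have "odd (n - 1)" using n by simp
    ultimately have "F {u (2 * (l - 1) + 1), u 0} = - 1"
      using Fst(1)[of "n - 1"] n by (simp add: step_def)
    then show ?thesis
      by (auto simp: F_def edge_sign_def of_bool_def insert_commute split: if_splits)
  qed
  ultimately obtain j where j: "j < l - 1" "?T j" "\<not> ?T (Suc j)"
    using last_true_before_false[of ?T "l - 1"] by blast
  define k where "k = 2 * j + 1"
  have k: "odd k" "k + 2 < n" "k > 0" using j(1) l by (auto simp: k_def)
  define a b c d where "a = u 0" and "b = u (k + 1)" and "c = u k" and "d = u (k + 2)"
  have ac: "{a, c} \<in> G1" and ad: "{a, d} \<notin> G1"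
    using j(2,3) by (simp_all add: a_def c_def d_def k_def)
  have bc: "{b, c} = step u k" and bd: "{b, d} = step u (Suc k)"
    by (simp_all add: step_def b_def c_def d_def insert_commute)
  have Fbc: "F {b, c} = - 1" and Fbd: "F {b, d} = 1"
    unfolding bc bd using Fst(1)[of k] Fst(1)[of "Suc k"] k by auto
  have "{b, c} \<notin> G1" "{b, d} \<in> G1"
    using Fbc Fbd by (auto simp: F_def edge_sign_def of_bool_def split: if_splits)
  have "{b, c} \<noteq> {b, d}" unfolding bc bd using inj_onD[OF inj, of k "Suc k"] k by auto
  \<comment> \<open>\<open>a\<close> differs from the others because the start is visited once;
    \<open>c\<close> and \<open>d\<close> differ because edges \<open>k\<close> and
    \<open>k + 1\<close> do.\<close>
  then have dist: "distinct [a, b, c, d]"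
    using once[of k] once[of "k + 1"] once[of "k + 2"] Fst(2)[of k] Fst(2)[of "Suc k"] k
    by (auto simp: a_def b_def c_def d_def)
  define G where "G = (G1 - {{a, c}, {b, d}}) \<union> {{b, c}, {a, d}}"
  have sw: "swap G1 G"
    unfolding swap_def G_def using dist ac ad \<open>{b, c} \<notin> G1\<close> \<open>{b, d} \<in> G1\<close> by blast
  have acU: "{a, c} \<in> U" and bdU: "{b, d} \<in> U" using ac \<open>{b, d} \<in> G1\<close> G12 by auto
  then have adU: "{a, d} \<in> U" using dist by (auto simp: U_def)
  define X Y where "X = step u ` {0..<k}" and "Y = step u ` {k + 2..<n}"
  have XY: "X \<subseteq> C" "Y \<subseteq> C" "X \<noteq> {}" "Y \<noteq> {}"
    using k by (auto simp: X_def Y_def stepC[symmetric])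
  have CU: "C \<subseteq> U" using CF FU by auto
  have mem: "step u i \<in> step u ` A \<longleftrightarrow> i \<in> A" if "i < n" "A \<subseteq> {..<n}" for i A
    using inj_on_image_mem_iff[OF inj, of i A] that by simp
  have sub: "{0..<k} \<subseteq> {..<n}" "{k + 2..<n} \<subseteq> {..<n}" using k by auto
  have cards: "card X = k" "card Y = n - k - 2" "card C = n"
    unfolding X_def Y_def stepC[symmetric]
    using sub by (simp_all add: card_image[OF inj_on_subset[OF inj]])
  \<comment> \<open>The swap deletes \<open>{a, c}\<close> from \<open>G1\<close> and inserts
    \<open>{a, d}\<close>, hence the signs. For \<open>k = 1\<close> the chord \<open>{a, c}\<close>
    is the only edge of \<open>X\<close> and \<open>gX\<close> vanishes; likewise \<open>gY\<close>
    for \<open>k + 3 = n\<close>.\<close>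
  define gX where "gX = (\<lambda>e. (if e \<in> X then F e else 0) + (- 1) * of_bool (e = {a, c}))"
  define gY where "gY = (\<lambda>e. (if e \<in> Y then F e else 0) + 1 * of_bool (e = {a, d}))"
  define F0 where "F0 = (\<lambda>e. if e \<in> C then 0 else F e)"
  have sumF: "F e = F0 e + (if e \<in> X then F e else 0) + (if e \<in> Y then F e else 0) +
      of_bool (e = {b, d}) - of_bool (e = {b, c})" for e
  proof (cases "e \<in> C")
    case False
    moreover have "{b, c} \<in> C" "{b, d} \<in> C" unfolding bc bd stepC[symmetric] using k by auto
    ultimately show ?thesis using XY by (auto simp: F0_def)
  next
    case True
    then obtain i where i: "i < n" "e = step u i" unfolding stepC[symmetric] by auto
    have "e = {b, c} \<longleftrightarrow> i = k" "e = {b, d} \<longleftrightarrow> i = Suc k"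
      unfolding bc bd i(2)
      using inj_on_eq_iff[OF inj, of i k] inj_on_eq_iff[OF inj, of i "Suc k"] i(1) k by simp_all
    moreover have "e \<in> X \<longleftrightarrow> i < k" "e \<in> Y \<longleftrightarrow> k + 2 \<le> i"
      unfolding X_def Y_def i(2) using mem[OF i(1) sub(1)] mem[OF i(1) sub(2)] i(1) by simp_all
    moreover have "i < k \<or> i = k \<or> i = Suc k \<or> k + 2 \<le> i" by linarith
    ultimately show ?thesis using True Fbc Fbd by (auto simp: F0_def)
  qed
  have eq: "edge_sign G G2 e = F0 e + gX e + gY e" for e
    using swap_edge_sign[OF dist ac \<open>{b, d} \<in> G1\<close> \<open>{b, c} \<notin> G1\<close> ad G_def, of G2 e] sumF[of e]
    unfolding F_def[symmetric] gX_def gY_def by linarith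
  have Fle: "\<bar>F e\<bar> \<le> 1" for e unfolding F_def by (rule edge_sign_le_1)
  have Fac: "F {a, c} \<ge> 0" using ac by (simp add: F_def edge_sign_def)
  \<comment> \<open>The pieces are added one after the other, so the intermediate sum needs the
    bound as well. Subtracting 1 on \<open>{a, c}\<close> is safe because \<open>F\<close> is
    nonnegative there.\<close>
  have le1: "\<bar>F0 e + gX e\<bar> \<le> 1" for e
  proof -
    have "F0 e + (if e \<in> X then F e else 0) \<in> {0, F e}" using XY by (auto simp: F0_def)
    then show ?thesis using Fle[of e] Fac unfolding gX_def by auto
  qed
  have wX: "vertex_weight gX U v = 0" for v
  proof -
    have "vertex_weight F X v = of_bool (v = a) + of_bool (v = c)"
      unfolding X_def using alt_trail_segment_weight[OF tr, of 0 k v] k by (simp add: a_def c_def)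
    moreover have "vertex_weight gX U v = vertex_weight F X v + (- 1) * of_bool (v \<in> {a, c})"
      unfolding gX_def by (rule vertex_weight_restrict_edge) (use U XY CU acU in auto)
    ultimately show ?thesis using dist by auto
  qed
  have wY: "vertex_weight gY U v = 0" for v
  proof -
    have "vertex_weight F Y v = - of_bool (v = d) - of_bool (v = a)"
      unfolding Y_def using alt_trail_segment_weight[OF tr, of "k + 2" n v] k n
      by (simp add: a_def d_def)
    moreover have "vertex_weight gY U v = vertex_weight F Y v + 1 * of_bool (v \<in> {a, d})"
      unfolding gY_def by (rule vertex_weight_restrict_edge) (use U XY CU adU in auto)
    ultimately show ?thesis using dist by auto
  qed
  have cX: "cost U gX \<le> int k - 1"
    using cost_restrict_edge[of U X "{a, c}" F "- 1"] U XY CU acU Fle cards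
    unfolding gX_def by auto
  have cY: "cost U gY \<le> int (n - k - 2) - 1"
    using cost_restrict_edge[of U Y "{a, d}" F 1] U XY CU adU Fle cards
    unfolding gY_def by auto
  have gXU: "e \<in> U" if "gX e \<noteq> 0" for e
    using that XY CU acU by (auto simp: gX_def split: if_splits)
  have gYU: "e \<in> U" if "gY e \<noteq> 0" for e
    using that XY CU adU by (auto simp: gY_def split: if_splits)
  have F0U: "e \<in> U" if "F0 e \<noteq> 0" for e
    using that FU by (auto simp: F0_def split: if_splits)
  have P0: "balanced_parts F0 (P - {C})"
    unfolding F0_def by (rule balanced_parts_remove[OF P' C])
  have "\<exists>P1. balanced_parts (\<lambda>e. F0 e + gX e) P1 \<and>
    int (card {e. F0 e + gX e \<noteq> 0}) - 2 * int (card P1)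
      \<le> int (card {e. F0 e \<noteq> 0}) - 2 * int (card (P - {C})) + cost U gX"
    by (rule balanced_parts_add[OF P0 U])
      (use F0U Fle gXU wX le1 in \<open>auto simp: F0_def\<close>)
  then obtain P1 where P1: "balanced_parts (\<lambda>e. F0 e + gX e) P1"
    "int (card {e. F0 e + gX e \<noteq> 0}) - 2 * int (card P1)
      \<le> int (card {e. F0 e \<noteq> 0}) - 2 * int (card (P - {C})) + cost U gX" by blast
  have "e \<in> U" if "F0 e + gX e \<noteq> 0" for e 
    using that F0U[of e] gXU[of e] by (cases "F0 e = 0") auto
  then have "\<exists>P2. balanced_parts (\<lambda>e. F0 e + gX e + gY e) P2 \<and>
    int (card {e. F0 e + gX e + gY e \<noteq> 0}) - 2 * int (card P2)
      \<le> int (card {e. F0 e + gX e \<noteq> 0}) - 2 * int (card P1) + cost U gY"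
    by (intro balanced_parts_add[OF P1(1) U])
      (use le1 gYU wY in \<open>auto simp: eq[symmetric] edge_sign_le_1\<close>)
  then obtain P2 where P2: "balanced_parts (edge_sign G G2) P2"
    "int (card {e. edge_sign G G2 e \<noteq> 0}) - 2 * int (card P2)
      \<le> int (card {e. F0 e + gX e \<noteq> 0}) - 2 * int (card P1) + cost U gY"
    unfolding eq[symmetric] by auto
  have "{e. F0 e \<noteq> 0} = {e. F e \<noteq> 0} - C" by (auto simp: F0_def)
  then have c0: "int (card {e. F0 e \<noteq> 0}) = int (card {e. F e \<noteq> 0}) - int n"
    using CF finF cards(3) card_mono[OF finF CF] finP(2)[OF C] by (simp add: card_Diff_subset of_nat_diff)
  have "Suc (card (P - {C})) = card P" using card_Suc_Diff1[OF finP(1) C] .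
  then have cP: "int (card (P - {C})) = int (card P) - 1" by linarith
  have "int (n - k - 2) = int n - int k - 2" using k by simp
  \<comment> \<open>Removing \<open>C\<close> saves \<open>n - 2\<close>, while the two pieces cost
    at most \<open>(k - 1) + (n - k - 3) = n - 4\<close>.\<close>
  then have "int (card {e. edge_sign G G2 e \<noteq> 0}) - 2 * int (card P2) \<le>
    int (card {e. F e \<noteq> 0}) - 2 * int (card P) - 2"
    using P1(2) P2(2) c0 cP cX cY by linarith
  then show ?thesis using sw P2(1) unfolding F_def by blast
qed

section \<open>Upper bound: induction on the excess\<close>

lemma balanced_parts_max:
  assumes "balanced_parts F P" "finite {e. F e \<noteq> 0}" "F {} = 0"
  shows "\<exists>P'. balanced_parts F P' \<and> (\<forall>Q. balanced_parts F Q \<longrightarrow> card Q \<le> card P')"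
proof (rule ex_has_greatest_nat[where P = "balanced_parts F" and f = card])
  show "\<forall>Q. balanced_parts F Q \<longrightarrow> card Q < Suc (card {e. F e \<noteq> 0})"
    using balanced_parts_card_le[OF _ assms(2,3)] by fastforce
qed (rule assms(1))

text \<open>\<open>m\<close> bounds the cost of the current partition. The partition is replaced by
  a maximum one before every swap, because only then are its parts known to be minimal.\<close>

lemma swap_distance_upper:
  assumes "simple_graph V G1" "simple_graph V G2" "balanced_parts (edge_sign G1 G2) P"
    and "card {e. edge_sign G1 G2 e \<noteq> 0} \<le> m + 2 * card P"
  shows "\<exists>k. (swap ^^ k) G1 G2 \<and> 2 * k \<le> m"
  using assms
proof (induction m arbitrary: G1 P rule: less_induct)
  case (less m)
  have fin: "finite {e. edge_sign G G2 e \<noteq> 0}" "edge_sign G G2 {} = 0" if "simple_graph V G" for G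
  proof -
    have "{e. edge_sign G G2 e \<noteq> 0} \<subseteq> {e. e \<subseteq> V \<and> card e = 2}"
      using that less.prems(2) unfolding edge_sign_support simple_graph_def by blast
    then show "finite {e. edge_sign G G2 e \<noteq> 0}" "edge_sign G G2 {} = 0"
      using less.prems(2) by (auto simp: simple_graph_def intro: finite_subset[OF _ finite_two_element_subsets])
  qed
  obtain Q where Q: "balanced_parts (edge_sign G1 G2) Q"
    "\<And>P. balanced_parts (edge_sign G1 G2) P \<Longrightarrow> card P \<le> card Q"
    using balanced_parts_max[OF less.prems(3) fin[OF less.prems(1)]] by blast
  have m: "card {e. edge_sign G1 G2 e \<noteq> 0} \<le> m + 2 * card Q"
    using less.prems(4) Q(2)[OF less.prems(3)] by linarith
  show ?case
  proof (cases "Q = {}")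
    case True
    then have "sym_diff G1 G2 = {}"
      using Q(1) by (simp add: balanced_parts_def edge_sign_support partition_on_def)
    then have "G1 = G2" by blast
    then show ?thesis by (intro exI[of _ 0]) simp
  next
    case False
    then obtain C where C: "C \<in> Q" by blast
    have min: "\<exists>v. vertex_weight (edge_sign G1 G2) D v \<noteq> 0" if D: "D \<subset> C" "D \<noteq> {}" for D
    proof (rule ccontr)
      assume "\<not> ?thesis"
      then obtain P' where "balanced_parts (edge_sign G1 G2) P'" "card P' = Suc (card Q)"
        using balanced_parts_refine[OF Q(1) fin(1)[OF less.prems(1)] C D] by auto
      then show False using Q(2)[of P'] by simp
    qed
    obtain G P' where G: "swap G1 G" "balanced_parts (edge_sign G G2) P'"
      "int (card {e. edge_sign G G2 e \<noteq> 0}) - 2 * int (card P') \<le>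
       int (card {e. edge_sign G1 G2 e \<noteq> 0}) - 2 * int (card Q) - 2"
      using swap_step[OF less.prems(1,2) Q(1) C min] by blast
    have simG: "simple_graph V G" by (rule simple_graph_swap[OF G(1) less.prems(1)])
    \<comment> \<open>The cost after the swap is nonnegative, so a drop by 2 forces
      \<open>m \<ge> 2\<close> and the subtraction \<open>m - 2\<close> is exact.\<close>
    have "2 * card P' \<le> card {e. edge_sign G G2 e \<noteq> 0}"
      by (rule balanced_parts_card_le[OF G(2) fin[OF simG]])
    then have m': "m \<ge> 2" "card {e. edge_sign G G2 e \<noteq> 0} \<le> (m - 2) + 2 * card P'"
      using G(3) m by linarith+
    then obtain k where "(swap ^^ k) G G2" "2 * k \<le> m - 2"
      using less.IH[of "m - 2" G P'] simG less.prems(2) G(2) by auto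
    then show ?thesis
      using relpowp_Suc_I2[of swap G1 G k G2] G(1) m'(1) by (intro exI[of _ "Suc k"]) auto
  qed
qed

section \<open>Alternating circuits as closed walks\<close>

lemma walk_edges_eq_steps: "walk_edges vs = map (step ((!) vs)) [0..<length vs - 1]"
  by (rule nth_equalityI) (auto simp: walk_edges_def step_def nth_tl)

lemma walk_edges_map: "walk_edges (map u [0..<Suc n]) = map (step u) [0..<n]"
  by (rule nth_equalityI) (simp_all add: walk_edges_eq_steps step_def del: upt_Suc)

text \<open>The wraparound condition forces even length, and then the two endpoint terms of the
  whole trail cancel. The circuit may start with a blue edge, so the trail has sign
  \<open>F (step u 0)\<close>.\<close>

lemma alternating_circuit_balanced:
  assumes simp1: "simple_graph V G1" and simp2: "simple_graph V G2"
    and circ: "alternating_circuit (G1 - G2) (G2 - G1) vs"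
  shows "vertex_weight (edge_sign G1 G2) (set (walk_edges vs)) v = 0"
proof -
  define F where "F = edge_sign G1 G2"
  define n where "n = length vs - 1"
  define u where "u = (!) vs"
  have we: "walk_edges vs = map (step u) [0..<n]"
    unfolding n_def u_def by (rule walk_edges_eq_steps)
  have c: "length vs \<ge> 2" "hd vs = last vs" "step u ` {0..<n} \<subseteq> sym_diff G1 G2"
    "inj_on (step u) {0..<n}"
    using circ unfolding alternating_circuit_def circuit_def we by (simp_all add: distinct_map)
  have n: "n > 0" using c(1) by (simp add: n_def)
  have alt: "(step u i \<in> G1 - G2) \<noteq> (step u (Suc i mod n) \<in> G1 - G2)" if "i < n" for i
  proof -
    define R where "R = G1 - G2"
    have "\<forall>i<n. (map (step u) [0..<n] ! i \<in> R) \<noteq> (map (step u) [0..<n] ! (Suc i mod n) \<in> R)"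
      using conjunct2[OF circ[unfolded alternating_circuit_def]]
      unfolding we Let_def R_def[symmetric]
      by (simp only: length_map length_upt diff_zero)
    from this[rule_format, OF that] show ?thesis
      using that n unfolding R_def[symmetric] by simp
  qed
  have closed: "u n = u 0"
  proof -
    have "vs \<noteq> []" using c(1) by auto
    then show ?thesis using c(2) by (simp add: u_def n_def hd_conv_nth last_conv_nth)
  qed
  have sd: "step u i \<in> sym_diff G1 G2" if "i < n" for i
    by (rule subsetD[OF c(3)]) (use that in simp)
  have F: "F (step u i) = (if step u i \<in> G1 - G2 then 1 else - 1)" if "i < n" for i
    using sd[OF that] by (auto simp: F_def edge_sign_def)
  have flip: "F (step u (Suc i mod n)) = - F (step u i)" if "i < n" for i
  proof -
    have "Suc i mod n < n" using n by simp
    then show ?thesis using F[OF that] F[of "Suc i mod n"] alt[OF that] by auto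
  qed
  have sign: "F (step u i) = F (step u 0) * (-1) ^ i" if "i < n" for i
    using that
  proof (induction i)
    case (Suc i)
    then show ?case using flip[of i] by simp
  qed simp
  have neq: "u i \<noteq> u (Suc i)" if "i < n" for i
  proof
    assume "u i = u (Suc i)"
    then have "card (step u i) = 1" by (simp add: step_def)
    moreover have "card (step u i) = 2"
      using sd[OF that] simp1 simp2 by (auto simp: simple_graph_def)
    ultimately show False by simp
  qed
  have tr: "alt_trail F (F (step u 0)) u n"
    unfolding alt_trail_def
  proof (intro conjI allI impI)
    show "inj_on (step u) {..<n}" using c(4) by (simp add: atLeast0LessThan)
  qed (use neq in blast, rule sign)
  have "even n"
  proof (rule ccontr)
    assume "odd n"
    then have "F (step u (n - 1)) = F (step u 0)" using sign[of "n - 1"] n by simp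
    moreover have "F (step u 0) = - F (step u (n - 1))" using flip[of "n - 1"] n by simp
    ultimately show False using F[of 0] n by (simp split: if_splits)
  qed
  then show ?thesis
    unfolding we F_def[symmetric] using alt_trail_segment_weight[OF tr, of 0 n v] closed by simp
qed

lemma closed_alt_trail_circuit:
  assumes tr: "alt_trail (edge_sign G1 G2) 1 u n" and n: "n > 0" "even n" "u n = u 0"
  shows "alternating_circuit (G1 - G2) (G2 - G1) (map u [0..<Suc n])"
proof -
  have sign: "edge_sign G1 G2 (step u i) = (-1) ^ i" if "i < n" for i
    using tr that by (simp add: alt_trail_def)
  have red: "step u i \<in> G1 - G2 \<longleftrightarrow> even i" if "i < n" for i
    using sign[OF that] by (cases "even i") (auto simp: edge_sign_def of_bool_def split: if_splits)
  have "step u ` {0..<n} \<subseteq> sym_diff G1 G2"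
    unfolding edge_sign_support[symmetric] using sign by auto
  moreover have "inj_on (step u) {0..<n}"
    using tr by (simp add: alt_trail_def atLeast0LessThan)
  moreover have "hd (map u [0..<Suc n]) = last (map u [0..<Suc n])"
    using n by (simp add: hd_map hd_upt del: upt_Suc) (simp add: last_map)
  ultimately have circ: "circuit (sym_diff G1 G2) (map u [0..<Suc n])"
    using n unfolding circuit_def walk_edges_map by (simp add: distinct_map)
  have alt: "(step u i \<in> G1 - G2) \<noteq> (step u (Suc i mod n) \<in> G1 - G2)" if "i < n" for i
  proof -
    have "Suc i mod n < n" using n by simp
    moreover have "even (Suc i mod n) \<longleftrightarrow> odd i" using n(2) by (simp add: dvd_mod_iff)
    ultimately show ?thesis using red that by simp
  qed
  show ?thesis
    unfolding alternating_circuit_def walk_edges_map Let_def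
  proof (intro conjI allI impI circ)
    fix i assume "i < length (map (step u) [0..<n])"
    then have i: "i < n" by simp
    then show "(map (step u) [0..<n] ! i \<in> G1 - G2) \<noteq>
        (map (step u) [0..<n] ! (Suc i mod length (map (step u) [0..<n])) \<in> G1 - G2)"
      using alt[OF i] n(1) by simp
  qed
qed

text \<open>Alternating decompositions are balanced partitions, which bounds their size. Conversely
  a balanced set need not be one circuit (two disjoint circuits form one), but the parts of a
  maximum partition are minimal and therefore are.\<close>

lemma maxC_u_eq_card:
  assumes simp1: "simple_graph V G1" and simp2: "simple_graph V G2"
    and P: "balanced_parts (edge_sign G1 G2) P"
    and max: "\<And>Q. balanced_parts (edge_sign G1 G2) Q \<Longrightarrow> card Q \<le> card P"
  shows "maxC_u G1 G2 = card P"
proof -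
  let ?F = "edge_sign G1 G2"
  have card2: "card e = 2" if "e \<in> sym_diff G1 G2" for e
    using that simp1 simp2 by (auto simp: simple_graph_def)
  have "sym_diff G1 G2 \<subseteq> {e. e \<subseteq> V \<and> card e = 2}"
    using simp1 simp2 unfolding simple_graph_def by blast
  then have fin: "finite {e. ?F e \<noteq> 0}"
    using simp1 unfolding edge_sign_support simple_graph_def
    by (auto intro: finite_subset[OF _ finite_two_element_subsets])
  note finP = balanced_parts_finite[OF P fin]
  have "alternating_decomposition (G1 - G2) (G2 - G1) P"
    unfolding alternating_decomposition_def
  proof (intro conjI ballI)
    show "partition_on (sym_diff G1 G2) P"
      using P by (simp add: balanced_parts_def edge_sign_support)
    fix C assume C: "C \<in> P"
    have sub: "C \<subseteq> sym_diff G1 G2" "C \<noteq> {}" "\<And>v. vertex_weight ?F C v = 0"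
      using P C by (auto simp: balanced_parts_def edge_sign_support partition_on_def)
    have "\<exists>u n. n > 0 \<and> even n \<and> u n = u 0 \<and> alt_trail ?F 1 u n \<and> step u ` {..<n} = C \<and>
      (\<forall>k. 0 < k \<and> k < n \<longrightarrow> u k \<noteq> u 0)"
    proof (rule minimal_balanced_closed_trail)
      fix e assume "e \<in> C"
      then have "e \<in> sym_diff G1 G2" using sub by blast
      then show "card e = 2" "?F e = 1 \<or> ?F e = - 1"
        using card2 by (auto simp: edge_sign_def)
    next
      fix D assume D: "D \<subset> C" "D \<noteq> {}"
      show "\<exists>v. vertex_weight ?F D v \<noteq> 0"
      proof (rule ccontr)
        assume "\<not> ?thesis"
        then obtain P' where "balanced_parts ?F P'" "card P' = Suc (card P)"
          using balanced_parts_refine[OF P fin C D] by auto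
        then show False using max[of P'] by simp
      qed
    qed (use sub finP(2)[OF C] in auto)
    then obtain u n where "n > 0" "even n" "u n = u 0" "alt_trail ?F 1 u n" "step u ` {..<n} = C"
      by blast
    then show "\<exists>vs. alternating_circuit (G1 - G2) (G2 - G1) vs \<and> set (walk_edges vs) = C"
      by (intro exI[of _ "map u [0..<Suc n]"])
        (simp add: closed_alt_trail_circuit walk_edges_map atLeast0LessThan del: upt_Suc)
  qed
  moreover have "card Q \<le> card P" if "alternating_decomposition (G1 - G2) (G2 - G1) Q" for Q
  proof (rule max)
    show "balanced_parts ?F Q"
      using that alternating_circuit_balanced[OF simp1 simp2]
      unfolding alternating_decomposition_def balanced_parts_def edge_sign_support by metis
  qed
  moreover have "finite {Q. alternating_decomposition (G1 - G2) (G2 - G1) Q}"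
  proof (rule finite_subset)
    show "{Q. alternating_decomposition (G1 - G2) (G2 - G1) Q} \<subseteq> Pow (Pow (sym_diff G1 G2))"
      by (auto simp: alternating_decomposition_def partition_on_def)
    show "finite (Pow (Pow (sym_diff G1 G2)))" using fin unfolding edge_sign_support by simp
  qed
  ultimately show ?thesis
    unfolding maxC_u_def maxC_def by (intro Max_eqI) auto
qed

lemma balanced_parts_edge_sign_exists:
  assumes "realizes V G1 d" "realizes V G2 d"
  shows "\<exists>P. balanced_parts (edge_sign G1 G2) P"
proof -
  let ?F = "edge_sign G1 G2" and ?R = "G1 - G2" and ?B = "G2 - G1"
  have g: "simple_graph V (?R \<union> ?B)" and deg: "\<And>v. v \<in> V \<Longrightarrow> degree ?R v = degree ?B v"
    using associated_graph_balanced[OF assms] by (auto simp: balanced_def red_blue_graph_def)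
  have "finite (?R \<union> ?B)"
    by (rule finite_subset[of _ "Pow V"]) (use g in \<open>auto simp: simple_graph_def\<close>)
  then have fin: "finite ?R" "finite ?B" by auto
  have "vertex_weight ?F (?R \<union> ?B) v = 0" for v
  proof -
    have "vertex_weight ?F (?R \<union> ?B) v = vertex_weight ?F ?R v + vertex_weight ?F ?B v"
      by (rule vertex_weight_Un) (use fin in auto)
    moreover have "vertex_weight ?F ?R v = int (degree ?R v)"
    proof -
      have "vertex_weight ?F ?R v = (\<Sum>e\<in>?R. of_bool (v \<in> e))"
        unfolding vertex_weight_def by (rule sum.cong) (auto simp: edge_sign_def)
      then show ?thesis using fin by (simp add: degree_def Int_def)
    qed
    moreover have "vertex_weight ?F ?B v = - int (degree ?B v)"
    proof -
      have "vertex_weight ?F ?B v = (\<Sum>e\<in>?B. - of_bool (v \<in> e))"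
        unfolding vertex_weight_def by (rule sum.cong) (auto simp: edge_sign_def)
      then show ?thesis using fin by (simp add: degree_def Int_def sum_negf)
    qed
    moreover have "degree ?R v = degree ?B v"
    proof (cases "v \<in> V")
      case False
      then have "{e \<in> ?R. v \<in> e} = {}" "{e \<in> ?B. v \<in> e} = {}"
        using g unfolding simple_graph_def by blast+
      then show ?thesis by (simp only: degree_def)
    qed (rule deg)
    ultimately show ?thesis by simp
  qed
  \<comment> \<open>The whole symmetric difference is one part; removing \<open>{}\<close> covers
    \<open>G1 = G2\<close>.\<close>
  then have "balanced_parts ?F ({?R \<union> ?B} - {{}})"
    unfolding balanced_parts_def edge_sign_support
    by (auto simp: partition_on_def disjoint_def)
  then show ?thesis ..
qed

theorem theorem3p6:
  fixes V :: "'a set" and d :: "'a \<Rightarrow> nat" and G1 G2 :: "'a set set"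
  assumes "\<forall>v\<in>V. d v > 0"
    and "realizes V G1 d"
    and "realizes V G2 d"
  shows "ereal_of_enat (dist_u G1 G2) = ereal (half_hamming G1 G2 - real (maxC_u G1 G2))"
proof -
  let ?F = "edge_sign G1 G2"
  have simp: "simple_graph V G1" "simple_graph V G2"
    using assms(2,3) by (auto simp: realizes_def)
  have "sym_diff G1 G2 \<subseteq> {e. e \<subseteq> V \<and> card e = 2}"
    using simp unfolding simple_graph_def by blast
  then have fin: "finite {e. ?F e \<noteq> 0}" and empty: "?F {} = 0"
    using simp unfolding edge_sign_support simple_graph_def
    by (auto simp: edge_sign_def intro: finite_subset[OF _ finite_two_element_subsets])
  obtain P where P: "balanced_parts ?F P" "\<And>Q. balanced_parts ?F Q \<Longrightarrow> card Q \<le> card P"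
    using balanced_parts_edge_sign_exists[OF assms(2,3)] balanced_parts_max[OF _ fin empty] by blast
  have max: "maxC_u G1 G2 = card P" by (rule maxC_u_eq_card[OF simp P])
  have "2 * card P \<le> card {e. ?F e \<noteq> 0}" by (rule balanced_parts_card_le[OF P(1) fin empty])
  then obtain k where k: "(swap ^^ k) G1 G2" "2 * k \<le> card {e. ?F e \<noteq> 0} - 2 * card P"
    using swap_distance_upper[OF simp P(1), of "card {e. ?F e \<noteq> 0} - 2 * card P"] by auto
  have lower: "card {e. ?F e \<noteq> 0} \<le> 2 * j + 2 * card P" if j: "(swap ^^ j) G1 G2" for j
  proof -
    obtain Q where "balanced_parts ?F Q" "int (card {e. ?F e \<noteq> 0}) - 2 * int (card Q) \<le> 2 * int j"
      using swap_distance_lower[OF j simp(1)] by blast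
    then show ?thesis using P(2)[of Q] by linarith
  qed
  \<comment> \<open>The lower bound is applied to the very \<open>k\<close> that the upper bound
    provides.\<close>
  have eq: "card (sym_diff G1 G2) = 2 * k + 2 * card P"
    using lower[OF k(1)] k(2) \<open>2 * card P \<le> _\<close> unfolding edge_sign_support by linarith
  have "dist_u G1 G2 = enat k"
    unfolding dist_u_def
  proof (rule antisym)
    show "(INF k\<in>{k. (swap ^^ k) G1 G2}. enat k) \<le> enat k"
      by (rule INF_lower) (use k(1) in simp)
    show "enat k \<le> (INF k\<in>{k. (swap ^^ k) G1 G2}. enat k)"
    proof (rule INF_greatest)
      fix j assume "j \<in> {k. (swap ^^ k) G1 G2}"
      then show "enat k \<le> enat j" using lower[of j] eq unfolding edge_sign_support by simp
    qed
  qed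
  then show ?thesis using eq max by (simp add: half_hamming_def field_simps)
qed

end
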